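(* Let $n\ge 1$, let $\mathbf{w}=\varepsilon L^{n-1}$ (the generalized snake word of length $n-1$ all of whose letters after $\varepsilon$ are $L$), and let $Q_{\mathbf{w}}$ be the poset of meet-irreducible elements of $\widehat P(\mathbf{w})$. The flip graph of triangulations of $\mathcal{O}(Q_{\mathbf{w}})$ is (isomorphic to) the Cayley graph of the symmetric group $\mathfrak{S}_{n+1}$ with the simple transpositions as the generating set.
   Context: The generalized snake poset $P(\mathbf{w})$ of $\mathbf{w}=w_0w_1\cdots w_m$ ($w_0=\varepsilon$ the empty letter, $w_i\in\{L,R\}$ for $i\ge1$) is defined recursively ($\prec$ denotes a cover relation). $P(\varepsilon)$ is the poset on $\{0,1,2,3\}$ with cover relations $1\prec 0$, $2\prec 0$, $3\prec 1$, $3\prec 2$. For $m\ge 1$, $P(w_0\cdots w_m)$ is $P(w_0\cdots w_{m-1})\cup\{2m+2,2m+3\}$ with the added cover relations $2m+3\prec 2m+1$, $2m+3\prec 2m+2$, and: $2m+2\prec 2m-1$ if ($m=1$ and $w_m=L$) or ($m\ge2$ and $w_{m-1}w_m\in\{RL,LR\}$); $2m+2\prec 2m$ if ($m=1$ and $w_m=R$) or ($m\ge 2$ and $w_{m-1}w_m\in\{LL,RR\}$). Thus for $\mathbf{w}=\varepsilon L^{n-1}$, $P(\mathbf{w})$ is the product of an $(n+1)$-element chain and a $2$-element chain. $\widehat{P}(\mathbf{w})$ is $P(\mathbf{w})$ with a new minimum $\widehat 0$ and a new maximum $\widehat 1$ adjoined; it is a distributive lattice. Meet-irreducible elements are the elements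 $\ne\widehat 1$ covered by exactly one element, with the induced order. For a finite poset $Q$, the order polytope is $\mathcal{O}(Q)=\{x\in[0,1]^Q: x_i\le x_j \text{ whenever } i<_Q j\}$; its vertices are the indicator vectors of the filters of $Q$. Triangulations of $\mathcal{O}(Q)$ are triangulations of its vertex set: collections of full-dimensional simplices with vertices among the vertices of $\mathcal{O}(Q)$, with union $\mathcal{O}(Q)$, any two meeting in a common face. A circuit $Z$ of a point configuration is a minimal affinely dependent subset; its unique affine dependence gives a partition $Z=Z_+\sqcup Z_-$ by sign of coefficients. $Z$ has exactly two triangulations $\mathcal{T}_Z^{\pm}$, with maximal simplices $Z\setminus\{z\}$, $z\in Z_{\pm}$. Two triangulations $\mathcal{T}_1,\mathcal{T}_2$ (viewed as simplicial complexes) differ by a flip if there is a circuit $Z$ such that (up to exchanging $Z_+$ and $Z_-$) $\mathcal{T}_1$ contains $\mathcal{T}_Z^+$, all maximal simplices of $\mathcal{T}_Z^+$ have the same link $\mathrm{L}$ in $\mathcal{T}_1$, and $\mathcal{T}_2$ is obtained from $\mathcal{T}_1$ by replacing $\mathcal{T}_Z^+*\mathrm{L}$ by $\mathcal{T}_Z^-*\mathrm{L}$ (with $*$ the join). The flip graph has all triangulations as vertices, with two adjacent when they differ by a flip. The simple transpositions of $\mathfrak{S}_{n+1}$ are $(i\ i{+}1)$, $1\le i\le n$; the Cayley graph is taken as an undirected simple graph. *)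

theory Defs
  imports "HOL-Analysis.Analysis" "HOL-Analysis.Finite_Function_Topology" "HOL-Algebra.Sym_Groups"
begin

section \<open>Posets\<close>

text \<open>
  Throughout, a poset is represented by its reflexive order relation \<open>r\<close>, where
  \<open>(x, y) \<in> r\<close> means \<open>x \<le> y\<close>; its ground set is \<open>Field r\<close>.
\<close>

definition covered_by :: "'a rel \<Rightarrow> 'a \<Rightarrow> 'a \<Rightarrow> bool" where
  "covered_by r x y \<longleftrightarrow>
     (x, y) \<in> r \<and> x \<noteq> y \<and> \<not> (\<exists>z. z \<noteq> x \<and> z \<noteq> y \<and> (x, z) \<in> r \<and> (z, y) \<in> r)"

datatype 'a hat = Bot | Elt 'a | Top

definition hat_poset :: "'a rel \<Rightarrow> 'a hat rel" where
  "hat_poset r = {(x, y).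
     x \<in> {Bot, Top} \<union> Elt ` Field r \<and> y \<in> {Bot, Top} \<union> Elt ` Field r \<and>
     (x = Bot \<or> y = Top \<or> (\<exists>a b. x = Elt a \<and> y = Elt b \<and> (a, b) \<in> r))}"

definition meet_irreducibles :: "'a hat rel \<Rightarrow> 'a hat set" where
  "meet_irreducibles r = {x \<in> Field r. x \<noteq> Top \<and> (\<exists>!y. covered_by r x y)}"


section \<open>Generalized snake posets\<close>

datatype letter = LetterL | LetterR

text \<open>
  The word \<open>w\<^sub>0w\<^sub>1\<dots>w\<^sub>m\<close> with \<open>w\<^sub>0 = \<epsilon>\<close> is represented by the list \<open>[w\<^sub>1, \<dots>, w\<^sub>m]\<close>.
\<close>

definition letter_at :: "letter list \<Rightarrow> nat \<Rightarrow> letter" where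
  "letter_at w i = w ! (i - 1)"

text \<open>
  The second argument is the length \<open>m\<close> of the prefix \<open>w\<^sub>0\<dots>w\<^sub>m\<close> under consideration;
  a pair \<open>(x, y)\<close> stands for \<open>x \<prec> y\<close>.
\<close>

primrec snake_covers :: "letter list \<Rightarrow> nat \<Rightarrow> nat rel" where
  "snake_covers w 0 = {(1, 0), (2, 0), (3, 1), (3, 2)}"
| "snake_covers w (Suc k) = snake_covers w k \<union>
     (let m = Suc k in
        {(2 * m + 3, 2 * m + 1), (2 * m + 3, 2 * m + 2)} \<union>
        (if (m = 1 \<and> letter_at w m = LetterL) \<or>
            (m \<ge> 2 \<and> (letter_at w (m - 1), letter_at w m)
                         \<in> {(LetterR, LetterL), (LetterL, LetterR)})
         then {(2 * m + 2, 2 * m - 1)} else {}) \<union>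
        (if (m = 1 \<and> letter_at w m = LetterR) \<or>
            (m \<ge> 2 \<and> (letter_at w (m - 1), letter_at w m)
                         \<in> {(LetterL, LetterL), (LetterR, LetterR)})
         then {(2 * m + 2, 2 * m)} else {}))"

definition snake_poset :: "letter list \<Rightarrow> nat rel" where
  "snake_poset w = Restr ((snake_covers w (length w))\<^sup>*) {0..2 * length w + 3}"

definition snake_Q :: "letter list \<Rightarrow> nat hat rel" where
  "snake_Q w = (let r = hat_poset (snake_poset w) in Restr r (meet_irreducibles r))"


section \<open>Order polytopes\<close>

text \<open>
  For a finite poset with ground set \<open>Q\<close>, the space \<open>\<real>\<^sup>Q\<close> is realized as the subspace of
  those finitely supported functions \<open>'a \<Rightarrow>\<^sub>0 real\<close> whose support lies in \<open>Q\<close>.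
\<close>

definition order_polytope :: "'a rel \<Rightarrow> ('a \<Rightarrow>\<^sub>0 real) set" where
  "order_polytope r = {x. Poly_Mapping.keys x \<subseteq> Field r \<and>
     (\<forall>i\<in>Field r. 0 \<le> Poly_Mapping.lookup x i \<and> Poly_Mapping.lookup x i \<le> 1) \<and>
     (\<forall>i j. (i, j) \<in> r \<and> i \<noteq> j \<longrightarrow> Poly_Mapping.lookup x i \<le> Poly_Mapping.lookup x j)}"


section \<open>Triangulations and flips\<close>

definition polytope_vertices :: "'v::real_vector set \<Rightarrow> 'v set" where
  "polytope_vertices P = {v. v extreme_point_of P}"

text \<open>
  A simplex is given by its (affinely independent) vertex set, and a triangulation by the set
  of its maximal simplices. The library constants \<open>simplex\<close> and \<open>triangulation\<close> are not usable
  here because they require the type class \<open>euclidean_space\<close>.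
\<close>

definition polytope_triangulations :: "'v::real_vector set \<Rightarrow> 'v set set set" where
  "polytope_triangulations P = {T.
     (\<forall>\<sigma>\<in>T. \<sigma> \<subseteq> polytope_vertices P \<and> \<not> affine_dependent \<sigma> \<and>
             affine hull \<sigma> = affine hull P) \<and>
     (\<Union>\<sigma>\<in>T. convex hull \<sigma>) = P \<and>
     (\<forall>\<sigma>\<in>T. \<forall>\<tau>\<in>T. (convex hull \<sigma> \<inter> convex hull \<tau>) face_of (convex hull \<sigma>) \<and>
                     (convex hull \<sigma> \<inter> convex hull \<tau>) face_of (convex hull \<tau>))}"

text \<open>Abstract simplicial complexes contain the empty face.\<close>

definition complex_of :: "'v set set \<Rightarrow> 'v set set" where
  "complex_of T = {\<rho>. \<exists>\<sigma>\<in>T. \<rho> \<subseteq> \<sigma>}"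

definition complex_link :: "'v set set \<Rightarrow> 'v set \<Rightarrow> 'v set set" where
  "complex_link K \<sigma> = {\<rho> \<in> K. \<rho> \<inter> \<sigma> = {} \<and> \<rho> \<union> \<sigma> \<in> K}"

definition complex_join :: "'v set set \<Rightarrow> 'v set set \<Rightarrow> 'v set set" where
  "complex_join K M = {\<rho> \<union> \<tau> | \<rho> \<tau>. \<rho> \<in> K \<and> \<tau> \<in> M}"

definition circuit :: "'v::real_vector set \<Rightarrow> bool" where
  "circuit Z \<longleftrightarrow> affine_dependent Z \<and> (\<forall>Y. Y \<subset> Z \<longrightarrow> \<not> affine_dependent Y)"

text \<open>
  The dependence \<open>u\<close> is unique up to a nonzero scalar, so the partition is unique up to
  exchanging \<open>Zp\<close> and \<open>Zm\<close>, and both orders satisfy the predicate.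
\<close>

definition circuit_partition :: "'v::real_vector set \<Rightarrow> 'v set \<Rightarrow> 'v set \<Rightarrow> bool" where
  "circuit_partition Z Zp Zm \<longleftrightarrow> circuit Z \<and>
     (\<exists>u. (\<Sum>z\<in>Z. u z) = 0 \<and> (\<Sum>z\<in>Z. u z *\<^sub>R z) = 0 \<and> (\<exists>z\<in>Z. u z \<noteq> (0::real)) \<and>
          Zp = {z \<in> Z. u z > 0} \<and> Zm = {z \<in> Z. u z < 0})"

definition circuit_triangulation :: "'v set \<Rightarrow> 'v set \<Rightarrow> 'v set set" where
  "circuit_triangulation Z Z' = {Z - {z} | z. z \<in> Z'}"

text \<open>
  Exchanging \<open>Z\<^sub>+\<close> and \<open>Z\<^sub>-\<close> is covered by the symmetry of \<open>circuit_partition\<close>. In the last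
  clause, the faces common to both joins are removed and then added again.
\<close>

definition differ_by_flip ::
  "'v::real_vector set \<Rightarrow> 'v set set \<Rightarrow> 'v set set \<Rightarrow> bool" where
  "differ_by_flip V T1 T2 \<longleftrightarrow> (\<exists>Z Zp Zm M.
     Z \<subseteq> V \<and> circuit_partition Z Zp Zm \<and>
     complex_of (circuit_triangulation Z Zp) \<subseteq> complex_of T1 \<and>
     (\<forall>\<sigma> \<in> circuit_triangulation Z Zp. complex_link (complex_of T1) \<sigma> = M) \<and>
     complex_of T2 =
       (complex_of T1 - complex_join (complex_of (circuit_triangulation Z Zp)) M)
       \<union> complex_join (complex_of (circuit_triangulation Z Zm)) M)"


section \<open>Graphs\<close>

text \<open>An undirected graph is a pair of a vertex set and a set of edges \<open>{u, v}\<close>.\<close>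

type_synonym 'a ugraph = "'a set \<times> 'a set set"

definition ugraph_isomorphic :: "'a ugraph \<Rightarrow> 'b ugraph \<Rightarrow> bool" where
  "ugraph_isomorphic G H \<longleftrightarrow> (\<exists>f. bij_betw f (fst G) (fst H) \<and>
     (\<forall>u\<in>fst G. \<forall>v\<in>fst G. {u, v} \<in> snd G \<longleftrightarrow> {f u, f v} \<in> snd H))"

definition flip_graph :: "'v::real_vector set \<Rightarrow> 'v set set ugraph" where
  "flip_graph P = (polytope_triangulations P,
     {{T1, T2} | T1 T2. T1 \<in> polytope_triangulations P \<and> T2 \<in> polytope_triangulations P \<and>
        T1 \<noteq> T2 \<and> differ_by_flip (polytope_vertices P) T1 T2})"

definition cayley_graph :: "('a, 'b) monoid_scheme \<Rightarrow> 'a set \<Rightarrow> 'a ugraph" where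
  "cayley_graph G S = (carrier G,
     {{g, g \<otimes>\<^bsub>G\<^esub> s} | g s. g \<in> carrier G \<and> s \<in> S \<and> g \<noteq> g \<otimes>\<^bsub>G\<^esub> s})"

definition simple_transpositions :: "nat \<Rightarrow> (nat \<Rightarrow> nat) set" where
  "simple_transpositions n = {Transposition.transpose i (i + 1) | i. 1 \<le> i \<and> i \<le> n}"

end

theory Submission
  imports Defs
begin

text \<open>
  For \<open>w = \<epsilon>L\<^sup>n\<^sup>-\<^sup>1\<close> the poset \<open>Q\<^sub>w\<close> consists of a minimum, a maximum, and
  between them an \<open>n\<close>-element chain next to a single incomparable element. Hence its order polytope
  is an iterated pyramid over the prism \<open>\<Delta>\<^sub>n \<times> [0, 1]\<close>, and neither apex takes part in an
  affine dependence, so triangulations, circuits and flips are those of the prism. Two full-dimensional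
  simplices meet in a common face only if no circuit \<open>{a i, b i, a j, b j}\<close> has \<open>a i, b j\<close> in the
  first and \<open>a j, b i\<close> in the second. This forces the index sets \<open>{i. a i \<in> \<sigma>}\<close> of the maximal
  simplices of a triangulation to form a maximal chain of nonempty sets, that is, a permutation
  of the \<open>n + 1\<close> indices. A circuit supports a flip exactly when its two indices are adjacent in the
  permutation, and the flip exchanges them.
\<close>

section \<open>Iterated pyramids over a prism\<close>

text \<open>The geometry is carried by weights on the fixed set \<open>V\<close>. Two combinations
  of equal total weight give the same point exactly when they agree at both apexes, in every column
  weight \<open>u (a i) + u (b i)\<close>, and in the total weight of the top; this is
  \<open>combination_eqD\<close> together with \<open>combination_eqI\<close>, and it replaces
  arguments by volume or dimension. The pairwise condition on simplices only arranges their index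
  sets in a chain; that the chain has no gap comes from covering the polytope. Each maximal simplex
  has exactly one full column, that is, one \<open>i\<close> with both \<open>a i\<close> and
  \<open>b i\<close>. Listed by the number of top vertices, the full columns form the permutation,
  so a flip exchanges neighbouring positions rather than values. This is multiplication on the
  right, as in the edges of the Cayley graph. Flips are stated for complexes with all their faces,
  triangulations by maximal simplices; the passage back works because all maximal simplices have
  \<open>N + 3\<close> vertices. In the application \<open>N = n + 1\<close>.\<close>

text \<open>
  The vertices \<open>a i\<close> and \<open>b i\<close> form the top and the bottom of a prism over a simplex, and the
  apexes are \<open>0\<close> and \<open>q\<close>. In a combination of the vertices, \<open>s i\<close> reads off the joint weight of
  \<open>a i\<close> and \<open>b i\<close>, \<open>t\<close> the total weight of the top, and \<open>g\<close> the weight of \<open>q\<close>.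
\<close>

locale prism =
  fixes N :: nat and a b :: "nat \<Rightarrow> 'v::real_vector" and q :: 'v
    and s :: "nat \<Rightarrow> 'v \<Rightarrow> real" and t g :: "'v \<Rightarrow> real"
  assumes N_pos: "1 \<le> N"
    and linear_s: "linear (s i)" and linear_t: "linear t" and linear_g: "linear g"
    and s_a: "\<lbrakk>i \<in> {1..N}; j \<in> {1..N}\<rbrakk> \<Longrightarrow> s i (a j) = of_bool (i = j)"
    and s_b: "\<lbrakk>i \<in> {1..N}; j \<in> {1..N}\<rbrakk> \<Longrightarrow> s i (b j) = of_bool (i = j)"
    and s_q: "i \<in> {1..N} \<Longrightarrow> s i q = 0"
    and t_a: "i \<in> {1..N} \<Longrightarrow> t (a i) = 1" and t_b: "i \<in> {1..N} \<Longrightarrow> t (b i) = 0" and t_q: "t q = 0"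
    and g_a: "i \<in> {1..N} \<Longrightarrow> g (a i) = 0" and g_b: "i \<in> {1..N} \<Longrightarrow> g (b i) = 0" and g_q: "g q = 1"
    and parallel: "\<lbrakk>i \<in> {1..N}; j \<in> {1..N}\<rbrakk> \<Longrightarrow> a i + b j = a j + b i"
begin

section \<open>Weights of affine combinations and the functionals that read them off\<close>

definition V :: "'v set" where
  "V = {0, q} \<union> a ` {1..N} \<union> b ` {1..N}"

lemma finite_V: "finite V"
  by (simp add: V_def)

lemma functionals_0 [simp]: "s i 0 = 0" "t 0 = 0" "g 0 = 0"
  using linear_s linear_t linear_g by (simp_all add: linear_0)

lemma q_neq_0 [simp]: "q \<noteq> 0" "0 \<noteq> q"
  using g_q by auto

lemma a_eq_a [simp]: "\<lbrakk>i \<in> {1..N}; j \<in> {1..N}\<rbrakk> \<Longrightarrow> a i = a j \<longleftrightarrow> i = j"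
  using s_a[of i i] s_a[of i j] by auto

lemma b_eq_b [simp]: "\<lbrakk>i \<in> {1..N}; j \<in> {1..N}\<rbrakk> \<Longrightarrow> b i = b j \<longleftrightarrow> i = j"
  using s_b[of i i] s_b[of i j] by auto

lemma a_neq [simp]:
  "\<lbrakk>i \<in> {1..N}; j \<in> {1..N}\<rbrakk> \<Longrightarrow> a i \<noteq> b j" "\<lbrakk>i \<in> {1..N}; j \<in> {1..N}\<rbrakk> \<Longrightarrow> b j \<noteq> a i"
  "i \<in> {1..N} \<Longrightarrow> a i \<noteq> 0" "i \<in> {1..N} \<Longrightarrow> a i \<noteq> q" "i \<in> {1..N} \<Longrightarrow> q \<noteq> a i"
  using t_a[of i] t_b[of j] t_q by auto

lemma b_neq [simp]:
  "i \<in> {1..N} \<Longrightarrow> b i \<noteq> 0" "i \<in> {1..N} \<Longrightarrow> b i \<noteq> q" "i \<in> {1..N} \<Longrightarrow> q \<noteq> b i"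
  using s_b[of i i] s_q[of i] by auto

lemma inj_ab: "inj_on a {1..N}" "inj_on b {1..N}"
  by (auto simp: inj_on_def)

lemma sum_V: "(\<Sum>v\<in>V. f v) = f 0 + f q + (\<Sum>i=1..N. f (a i)) + (\<Sum>i=1..N. f (b i))"
  for f :: "'v \<Rightarrow> 'w::real_vector"
proof -
  have "a ` {1..N} \<inter> b ` {1..N} = {}" "{0, q} \<inter> (a ` {1..N} \<union> b ` {1..N}) = {}"
    by auto
  moreover have "(\<Sum>v\<in>a ` {1..N}. f v) = (\<Sum>i=1..N. f (a i))" "(\<Sum>v\<in>b ` {1..N}. f v) = (\<Sum>i=1..N. f (b i))"
    using inj_ab by (simp_all add: sum.reindex)
  ultimately show ?thesis
    unfolding V_def Un_assoc by (subst sum.union_disjoint) (simp_all add: sum.union_disjoint)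
qed

lemma s_combination:
  assumes "i \<in> {1..N}"
  shows "s i (\<Sum>v\<in>V. u v *\<^sub>R v) = u (a i) + u (b i)"
proof -
  have "s i (\<Sum>v\<in>V. u v *\<^sub>R v) = (\<Sum>v\<in>V. u v * s i v)"
    using linear_s by (simp add: linear_sum linear_cmul)
  also have "\<dots> = (\<Sum>j=1..N. u (a j) * of_bool (i = j)) + (\<Sum>j=1..N. u (b j) * of_bool (i = j))"
    using assms by (simp add: sum_V s_a s_b s_q)
  finally show ?thesis
    using assms by (simp add: of_bool_def if_distrib cong: if_cong)
qed

lemma t_combination: "t (\<Sum>v\<in>V. u v *\<^sub>R v) = (\<Sum>i=1..N. u (a i))"
proof -
  have "t (\<Sum>v\<in>V. u v *\<^sub>R v) = (\<Sum>v\<in>V. u v * t v)"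
    using linear_t by (simp add: linear_sum linear_cmul)
  then show ?thesis
    by (simp add: sum_V t_a t_b t_q)
qed

lemma g_combination: "g (\<Sum>v\<in>V. u v *\<^sub>R v) = u q"
proof -
  have "g (\<Sum>v\<in>V. u v *\<^sub>R v) = (\<Sum>v\<in>V. u v * g v)"
    using linear_g by (simp add: linear_sum linear_cmul)
  then show ?thesis
    by (simp add: sum_V g_a g_b g_q)
qed

text \<open>Apply \<open>g\<close>, \<open>t\<close> and \<open>s i\<close> to the common point. No
  functional sees the weight of the apex \<open>0\<close>; it is recovered from the equality of
  total weights.\<close>

lemma combination_eqD:
  assumes "(\<Sum>v\<in>V. u v *\<^sub>R v) = (\<Sum>v\<in>V. w v *\<^sub>R v)" "sum u V = sum w V"
  shows "u q = w q" "u 0 = w 0" "(\<Sum>i=1..N. u (a i)) = (\<Sum>i=1..N. w (a i))"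
    and "i \<in> {1..N} \<Longrightarrow> u (a i) + u (b i) = w (a i) + w (b i)"
proof -
  show q: "u q = w q"
    using g_combination[of u] g_combination[of w] assms by simp
  show "(\<Sum>i=1..N. u (a i)) = (\<Sum>i=1..N. w (a i))"
    using t_combination[of u] t_combination[of w] assms by simp
  show ab: "u (a i) + u (b i) = w (a i) + w (b i)" if "i \<in> {1..N}" for i
    using s_combination[OF that, of u] s_combination[OF that, of w] assms by simp
  have "(\<Sum>i=1..N. u (a i) + u (b i)) = (\<Sum>i=1..N. w (a i) + w (b i))"
    using ab by (intro sum.cong) auto
  then show "u 0 = w 0"
    using assms(2) q by (simp add: sum_V sum.distrib)
qed

text \<open>Extending weights by zero lets points of different simplices be compared through sums
  over the one index set \<open>V\<close>.\<close>

lemma sum_extend: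
  assumes "\<sigma> \<subseteq> V"
  shows "(\<Sum>v\<in>V. (if v \<in> \<sigma> then u v else 0) *\<^sub>R v) = (\<Sum>v\<in>\<sigma>. u v *\<^sub>R v)"
    and "(\<Sum>v\<in>V. (if v \<in> \<sigma> then u v else 0)) = sum u \<sigma>"
proof -
  have "(\<Sum>v\<in>V. (if v \<in> \<sigma> then u v else 0) *\<^sub>R v) = (\<Sum>v\<in>V. (if v \<in> \<sigma> then u v *\<^sub>R v else 0))"
    by (rule sum.cong) auto
  moreover have "V \<inter> \<sigma> = \<sigma>"
    using assms by blast
  ultimately show "(\<Sum>v\<in>V. (if v \<in> \<sigma> then u v else 0) *\<^sub>R v) = (\<Sum>v\<in>\<sigma>. u v *\<^sub>R v)"
    and "(\<Sum>v\<in>V. (if v \<in> \<sigma> then u v else 0)) = sum u \<sigma>"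
    using finite_V by (simp_all add: sum.inter_restrict[symmetric])
qed

lemma mem_convex_hull_iff:
  assumes "\<sigma> \<subseteq> V"
  shows "x \<in> convex hull \<sigma> \<longleftrightarrow> (\<exists>u. (\<forall>v. 0 \<le> u v) \<and> (\<forall>v. v \<notin> \<sigma> \<longrightarrow> u v = 0) \<and> sum u V = 1 \<and>
    (\<Sum>v\<in>V. u v *\<^sub>R v) = x)"
    (is "_ \<longleftrightarrow> (\<exists>u. ?P u)")
proof
  have fin: "finite \<sigma>"
    using assms finite_V finite_subset by blast
  show "\<exists>u. ?P u" if x: "x \<in> convex hull \<sigma>"
  proof -
    obtain u where "(\<forall>v\<in>\<sigma>. 0 \<le> u v) \<and> sum u \<sigma> = 1 \<and> (\<Sum>v\<in>\<sigma>. u v *\<^sub>R v) = x"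
      using x unfolding convex_hull_finite[OF fin] mem_Collect_eq by (rule exE)
    then have "?P (\<lambda>v. if v \<in> \<sigma> then u v else 0)"
      using sum_extend[OF assms, of u] by simp
    then show ?thesis
      by (intro exI[of _ "\<lambda>v. if v \<in> \<sigma> then u v else 0"])
  qed
  show "x \<in> convex hull \<sigma>" if ex: "\<exists>u. ?P u"
  proof -
    obtain u where u: "?P u"
      using ex by (rule exE)
    have "sum u \<sigma> = sum u V" "(\<Sum>v\<in>\<sigma>. u v *\<^sub>R v) = (\<Sum>v\<in>V. u v *\<^sub>R v)"
      using u by (intro sum.mono_neutral_left finite_V assms; simp)+
    with u have "\<forall>v\<in>\<sigma>. 0 \<le> u v" "sum u \<sigma> = 1" "(\<Sum>v\<in>\<sigma>. u v *\<^sub>R v) = x"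
      by simp_all
    then show ?thesis
      unfolding convex_hull_finite[OF fin] mem_Collect_eq by (intro exI[of _ u] conjI)
  qed
qed

lemma mem_convex_hullE:
  assumes "\<sigma> \<subseteq> V" "x \<in> convex hull \<sigma>"
  obtains u where "\<forall>v. 0 \<le> u v" "\<forall>v. v \<notin> \<sigma> \<longrightarrow> u v = 0" "sum u V = 1" "(\<Sum>v\<in>V. u v *\<^sub>R v) = x"
proof -
  show thesis
    using mem_convex_hull_iff[OF assms(1), THEN iffD1, OF assms(2)]
  proof (rule exE)
    fix u
    assume "(\<forall>v. 0 \<le> u v) \<and> (\<forall>v. v \<notin> \<sigma> \<longrightarrow> u v = 0) \<and> sum u V = 1 \<and> (\<Sum>v\<in>V. u v *\<^sub>R v) = x"
    then show thesis
      by (intro that[of u]) simp_all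
  qed
qed

lemma mem_affine_hullE:
  assumes "\<sigma> \<subseteq> V" "x \<in> affine hull \<sigma>"
  obtains u where "\<forall>v. v \<notin> \<sigma> \<longrightarrow> u v = 0" "sum u V = 1" "(\<Sum>v\<in>V. u v *\<^sub>R v) = x"
proof -
  have "finite \<sigma>"
    using assms finite_V finite_subset by blast
  obtain u where u: "sum u \<sigma> = 1 \<and> (\<Sum>v\<in>\<sigma>. u v *\<^sub>R v) = x"
    using assms(2) unfolding affine_hull_finite[OF \<open>finite \<sigma>\<close>] mem_Collect_eq by (rule exE)
  show thesis
    by (rule that[of "\<lambda>v. if v \<in> \<sigma> then u v else 0"]) (simp_all add: sum_extend[OF assms(1)] u)
qed

section \<open>The vertices of the polytope\<close>

lemma a_in_V [simp]: "i \<in> {1..N} \<Longrightarrow> a i \<in> V" and b_in_V [simp]: "i \<in> {1..N} \<Longrightarrow> b i \<in> V"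
  and zero_in_V [simp]: "0 \<in> V" and q_in_V [simp]: "q \<in> V"
  by (auto simp: V_def)

lemma V_cases:
  assumes "v \<in> V"
  obtains "v = 0" | "v = q" | i where "i \<in> {1..N}" "v = a i" | i where "i \<in> {1..N}" "v = b i"
  using assms by (auto simp: V_def)

text \<open>The gap \<open>f v - f x\<close> is a weighted average of the gaps
  \<open>f v - f w\<close>, so it is nonnegative, and zero only if all weight sits at
  \<open>v\<close>. A segment with \<open>v\<close> in its interior would therefore have both ends
  equal to \<open>v\<close>.\<close>

lemma extreme_point_if_unique_max:
  fixes f :: "'v \<Rightarrow> real"
  assumes "linear f" "v \<in> V" "\<And>w. \<lbrakk>w \<in> V; w \<noteq> v\<rbrakk> \<Longrightarrow> f w < f v"
  shows "v extreme_point_of (convex hull V)"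
proof -
  have le: "f x \<le> f v \<and> (f x = f v \<longrightarrow> x = v)" if x: "x \<in> convex hull V" for x
  proof -
    obtain u where u: "\<forall>w. 0 \<le> u w" "\<forall>w. w \<notin> V \<longrightarrow> u w = 0" "sum u V = 1" "(\<Sum>w\<in>V. u w *\<^sub>R w) = x"
      using x by (rule mem_convex_hullE[OF subset_refl])
    have "f x = (\<Sum>w\<in>V. u w * f w)"
      unfolding u(4)[symmetric] by (simp add: linear_sum[OF assms(1)] linear_cmul[OF assms(1)])
    then have eq: "f v - f x = (\<Sum>w\<in>V. u w * (f v - f w))"
      by (simp add: right_diff_distrib sum_subtractf u(3) sum_distrib_right[symmetric])
    have nonneg: "0 \<le> u w * (f v - f w)" if "w \<in> V" for w
      using that u(1) assms(3)[of w] by (cases "w = v") auto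
    have "x = v" if "f x = f v"
    proof -
      have "\<forall>w\<in>V. u w * (f v - f w) = 0"
        using eq that nonneg finite_V sum_nonneg_eq_0_iff[of V "\<lambda>w. u w * (f v - f w)"] by simp
      then have z: "u w = 0" if "w \<in> V" "w \<noteq> v" for w
        using assms(3)[OF that] that by force
      have "sum u V = sum u {v}" "(\<Sum>w\<in>V. u w *\<^sub>R w) = (\<Sum>w\<in>{v}. u w *\<^sub>R w)"
        using z assms(2) finite_V by (intro sum.mono_neutral_right; simp)+
      then show ?thesis
        using u by simp
    qed
    moreover have "f x \<le> f v"
      using eq nonneg sum_nonneg[of V "\<lambda>w. u w * (f v - f w)"] by simp
    ultimately show ?thesis by blast
  qed
  have "v \<notin> open_segment x y" if "x \<in> convex hull V" "y \<in> convex hull V" for x y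
  proof
    assume "v \<in> open_segment x y"
    then obtain c where c: "x \<noteq> y" "0 < c" "c < 1" "v = (1 - c) *\<^sub>R x + c *\<^sub>R y"
      by (auto simp: in_segment)
    then have fv: "f v = (1 - c) * f x + c * f y"
      unfolding c(4) by (simp only: linear_add[OF assms(1)] linear_cmul[OF assms(1)] real_scaleR_def)
    have "(1 - c) * (f v - f x) + c * (f v - f y) = 0"
      using fv by (simp add: algebra_simps)
    moreover have "0 \<le> (1 - c) * (f v - f x)" "0 \<le> c * (f v - f y)"
      using le[OF that(1)] le[OF that(2)] c by auto
    ultimately have "(1 - c) * (f v - f x) = 0" "c * (f v - f y) = 0"
      by linarith+
    then have "x = v" "y = v"
      using c le[OF that(1)] le[OF that(2)] by auto
    then show False
      using c(1) by simp
  qed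
  then show ?thesis
    using assms(2) by (auto simp: extreme_point_of_def hull_inc)
qed

text \<open>Each vertex is exposed by an explicit functional: \<open>0\<close> by minus
  \<open>g\<close> minus the sum of all \<open>s i\<close>, the apex \<open>q\<close> by
  \<open>g\<close>, the vertex \<open>a i\<close> by \<open>s i + t\<close>, and \<open>b i\<close>
  by \<open>2 * s i - t\<close>.\<close>

lemma polytope_vertices_prism: "polytope_vertices (convex hull V) = V"
proof -
  have "v extreme_point_of (convex hull V)" if "v \<in> V" for v
    using that
  proof (cases v rule: V_cases)
    case 1
    define f where "f x = - g x - (\<Sum>i=1..N. s i x)" for x
    have "linear f"
      unfolding f_def by (intro linear_compose_sub linear_compose_neg linear_compose_sum linear_s linear_g ballI)
    moreover have "f w < f v" if "w \<in> V" "w \<noteq> v" for w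
      using that 1 by (cases w rule: V_cases) (auto simp: f_def s_a s_b s_q g_a g_b g_q)
    ultimately show ?thesis
      using that extreme_point_if_unique_max by blast
  next
    case 2
    have "g w < g v" if "w \<in> V" "w \<noteq> v" for w
      using that 2 by (cases w rule: V_cases) (auto simp: g_a g_b g_q)
    then show ?thesis
      using that extreme_point_if_unique_max linear_g by blast
  next
    case (3 i)
    have "linear (\<lambda>x. s i x + t x)"
      by (intro linear_compose_add linear_s linear_t)
    moreover have "s i w + t w < s i v + t v" if "w \<in> V" "w \<noteq> v" for w
      using that 3 by (cases w rule: V_cases) (auto simp: s_a s_b s_q t_a t_b t_q)
    ultimately show ?thesis
      using that extreme_point_if_unique_max by blast
  next
    case (4 i)
    have "linear (\<lambda>x. (s i x + s i x) - t x)"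
      by (intro linear_compose_add linear_compose_sub linear_s linear_t)
    moreover have "(s i w + s i w) - t w < (s i v + s i v) - t v" if "w \<in> V" "w \<noteq> v" for w
      using that 4 by (cases w rule: V_cases) (auto simp: s_a s_b s_q t_a t_b t_q)
    ultimately show ?thesis
      using that extreme_point_if_unique_max by blast
  qed
  then show ?thesis
    unfolding polytope_vertices_def using extreme_point_of_convex_hull by blast
qed

section \<open>Affine dependences, simplices and their faces\<close>

definition square :: "nat \<Rightarrow> nat \<Rightarrow> 'v set" where
  "square i j = {a i, b i, a j, b j}"

lemma sum_square:
  fixes f :: "'v \<Rightarrow> 'w::real_vector"
  assumes "i \<in> {1..N}" "j \<in> {1..N}" "i \<noteq> j"
  shows "(\<Sum>v\<in>square i j. f v) = f (a i) + f (b i) + f (a j) + f (b j)"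
  using assms by (simp add: square_def add.assoc)

lemma affine_dependent_square:
  assumes "i \<in> {1..N}" "j \<in> {1..N}" "i \<noteq> j"
  shows "affine_dependent (square i j)"
proof -
  define u :: "'v \<Rightarrow> real" where "u v = (if v = a i \<or> v = b j then 1 else - 1)" for v
  have u: "u (a i) = 1" "u (b i) = -1" "u (a j) = -1" "u (b j) = 1"
    using assms by (auto simp: u_def)
  have "a i - b i - a j + b j = (a i + b j) - (a j + b i)"
    by simp
  then have "a i - b i - a j + b j = 0"
    using parallel[OF assms(1,2)] by simp
  then have "(\<Sum>v\<in>square i j. u v) = 0" "(\<Sum>v\<in>square i j. u v *\<^sub>R v) = 0"
    using assms by (simp_all add: sum_square u)
  moreover have "a i \<in> square i j" "u (a i) \<noteq> 0" "finite (square i j)"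
    using u by (auto simp: square_def)
  ultimately show ?thesis
    using affine_dependent_explicit_finite by blast
qed

text \<open>Comparison with the zero combination: a dependence has no weight at the apexes and
  opposite weights at the two ends of each column.\<close>

lemma dependenceE:
  assumes "\<sigma> \<subseteq> V" "sum u \<sigma> = 0" "(\<Sum>v\<in>\<sigma>. u v *\<^sub>R v) = 0"
  obtains w where "\<And>v. v \<in> \<sigma> \<Longrightarrow> w v = u v" "\<And>v. v \<notin> \<sigma> \<Longrightarrow> w v = 0"
    and "w 0 = 0" "w q = 0" "(\<Sum>i=1..N. w (a i)) = 0" "\<And>i. i \<in> {1..N} \<Longrightarrow> w (b i) = - w (a i)"
proof -
  define w where "w = (\<lambda>v. if v \<in> \<sigma> then u v else 0)"
  have eq: "(\<Sum>v\<in>V. w v *\<^sub>R v) = (\<Sum>v\<in>V. (0::real) *\<^sub>R v)" "sum w V = sum (\<lambda>_. 0) V"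
    unfolding w_def sum_extend[OF assms(1)] using assms by auto
  show thesis
  proof (rule that[of w])
    show "w 0 = 0" "w q = 0" "(\<Sum>i=1..N. w (a i)) = 0"
      using combination_eqD[OF eq] by auto
    show "w (b i) = - w (a i)" if "i \<in> {1..N}" for i
      using combination_eqD(4)[OF eq that] by auto
  qed (simp_all add: w_def)
qed

text \<open>The weights of the top sum to zero, so a nonzero one at \<open>a i\<close> is
  accompanied by another at some \<open>a j\<close>. The opposite weights at \<open>b i\<close> and
  \<open>b j\<close> are nonzero as well, and nonzero weights occur only on \<sigma>.\<close>

lemma affine_dependent_iff:
  assumes "\<sigma> \<subseteq> V"
  shows "affine_dependent \<sigma> \<longleftrightarrow> (\<exists>i\<in>{1..N}. \<exists>j\<in>{1..N}. i \<noteq> j \<and> square i j \<subseteq> \<sigma>)"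
proof
  assume "affine_dependent \<sigma>"
  moreover have "finite \<sigma>"
    using assms finite_V finite_subset by blast
  ultimately obtain u v where u: "sum u \<sigma> = 0" "(\<Sum>v\<in>\<sigma>. u v *\<^sub>R v) = 0" "v \<in> \<sigma>" "u v \<noteq> 0"
    by (auto simp: affine_dependent_explicit_finite)
  obtain w where w\<sigma>: "\<And>v. v \<in> \<sigma> \<Longrightarrow> w v = u v" "\<And>v. v \<notin> \<sigma> \<Longrightarrow> w v = 0"
    and w: "w 0 = 0" "w q = 0" "(\<Sum>i=1..N. w (a i)) = 0" "\<And>i. i \<in> {1..N} \<Longrightarrow> w (b i) = - w (a i)"
    by (rule dependenceE[OF assms u(1,2)]) (rule that; simp)
  have "v \<in> V" "w v \<noteq> 0"
    using u assms w\<sigma> by auto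
  then obtain i where i: "i \<in> {1..N}" "w (a i) \<noteq> 0"
    using w by (cases v rule: V_cases) auto
  have "\<exists>j\<in>{1..N}. j \<noteq> i \<and> w (a j) \<noteq> 0"
  proof (rule ccontr)
    assume "\<not> ?thesis"
    then have "(\<Sum>j\<in>{1..N} - {i}. w (a j)) = 0"
      by (intro sum.neutral) auto
    then show False
      using w(3) i sum.remove[of "{1..N}" i "\<lambda>j. w (a j)"] by simp
  qed
  then obtain j where j: "j \<in> {1..N}" "j \<noteq> i" "w (a j) \<noteq> 0"
    by blast
  have "w (b i) \<noteq> 0" "w (b j) \<noteq> 0"
    using w(4)[OF i(1)] w(4)[OF j(1)] i(2) j(3) by auto
  then have "square i j \<subseteq> \<sigma>"
    using i j w\<sigma>(2) unfolding square_def by auto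
  then show "\<exists>i\<in>{1..N}. \<exists>j\<in>{1..N}. i \<noteq> j \<and> square i j \<subseteq> \<sigma>"
    using i j by (intro bexI[of _ i] bexI[of _ j] conjI) auto
next
  assume "\<exists>i\<in>{1..N}. \<exists>j\<in>{1..N}. i \<noteq> j \<and> square i j \<subseteq> \<sigma>"
  then show "affine_dependent \<sigma>"
    by (elim bexE conjE) (rule affine_dependent_subset[OF affine_dependent_square])
qed

lemma finite_subset_V: "\<sigma> \<subseteq> V \<Longrightarrow> finite \<sigma>"
  using finite_V by (rule rev_finite_subset)

lemma combination_unique:
  assumes \<sigma>: "\<sigma> \<subseteq> V" "\<not> affine_dependent \<sigma>"
    and u: "\<forall>v. v \<notin> \<sigma> \<longrightarrow> u v = 0" and w: "\<forall>v. v \<notin> \<sigma> \<longrightarrow> w v = 0"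
    and eq: "(\<Sum>v\<in>V. u v *\<^sub>R v) = (\<Sum>v\<in>V. w v *\<^sub>R v)" "sum u V = sum w V"
  shows "u = w"
proof -
  have "(\<Sum>v\<in>\<sigma>. (u v - w v) *\<^sub>R v) = (\<Sum>v\<in>V. (u v - w v) *\<^sub>R v)"
    "(\<Sum>v\<in>\<sigma>. u v - w v) = (\<Sum>v\<in>V. u v - w v)"
    using u w by (intro sum.mono_neutral_left finite_V \<sigma>; simp)+
  then have "(\<Sum>v\<in>\<sigma>. (u v - w v) *\<^sub>R v) = 0" "(\<Sum>v\<in>\<sigma>. u v - w v) = 0"
    using eq by (simp_all add: scaleR_diff_left sum_subtractf)
  then have "u v - w v = 0" if "v \<in> \<sigma>" for v
    using \<sigma>(2) that unfolding affine_dependent_explicit_finite[OF finite_subset_V[OF \<sigma>(1)]]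
    by (meson)
  then show ?thesis
    using u w by (intro ext) (metis eq_iff_diff_eq_0)
qed

lemma vertex_combination:
  assumes "v \<in> V"
  shows "(\<Sum>w\<in>V. of_bool (w = v) *\<^sub>R w) = v" "(\<Sum>w\<in>V. of_bool (w = v)) = (1::real)"
proof -
  have "(\<Sum>w\<in>V. of_bool (w = v) *\<^sub>R w) = (\<Sum>w\<in>{v}. of_bool (w = v) *\<^sub>R w)"
    "(\<Sum>w\<in>V. of_bool (w = v)) = (\<Sum>w\<in>{v}. of_bool (w = v) :: real)"
    using assms by (intro sum.mono_neutral_right finite_V; simp)+
  then show "(\<Sum>w\<in>V. of_bool (w = v) *\<^sub>R w) = v" "(\<Sum>w\<in>V. of_bool (w = v)) = (1::real)"
    by simp_all
qed

text \<open>An extreme point of the whole polytope stays extreme in every smaller hull that contains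
  it, and extreme points of a hull are among its generators.\<close>

lemma mem_simplex_if_mem_hull:
  assumes "v \<in> V" "\<tau> \<subseteq> V" "v \<in> convex hull \<tau>"
  shows "v \<in> \<tau>"
proof -
  have "v extreme_point_of (convex hull V)"
    using assms(1) polytope_vertices_prism by (auto simp: polytope_vertices_def)
  moreover have "convex hull \<tau> \<subseteq> convex hull V"
    using assms(2) by (rule hull_mono)
  ultimately have "v extreme_point_of (convex hull \<tau>)"
    using assms(3) unfolding extreme_point_of_def by blast
  then show ?thesis
    by (rule extreme_point_of_convex_hull)
qed

text \<open>A point common to the affine hull of \<rho> and the hull of the remaining vertices would
  have two weight functions with disjoint supports in \<sigma>. By uniqueness they coincide, hence
  vanish, although their total is 1.\<close>

lemma simplex_face:
  assumes \<sigma>: "\<sigma> \<subseteq> V" "\<not> affine_dependent \<sigma>" and "\<rho> \<subseteq> \<sigma>"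
  shows "(convex hull \<rho>) face_of (convex hull \<sigma>)"
proof (rule face_of_convex_hulls)
  show "affine hull \<rho> \<inter> convex hull (\<sigma> - \<rho>) = {}"
  proof (rule ccontr)
    assume "\<not> ?thesis"
    then obtain x where x: "x \<in> affine hull \<rho>" "x \<in> convex hull (\<sigma> - \<rho>)"
      by auto
    have sub: "\<rho> \<subseteq> V" "\<sigma> - \<rho> \<subseteq> V"
      using assms by auto
    obtain u where u: "\<forall>v. v \<notin> \<rho> \<longrightarrow> u v = 0" "sum u V = 1" "(\<Sum>v\<in>V. u v *\<^sub>R v) = x"
      by (rule mem_affine_hullE[OF sub(1) x(1)])
    obtain w where w: "\<forall>v. 0 \<le> w v" "\<forall>v. v \<notin> \<sigma> - \<rho> \<longrightarrow> w v = 0" "sum w V = 1" "(\<Sum>v\<in>V. w v *\<^sub>R v) = x"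
      by (rule mem_convex_hullE[OF sub(2) x(2)])
    have "u = w"
      using u w assms(3) by (intro combination_unique[OF \<sigma>]) auto
    then have "u v = 0" for v
      using u(1) w(2) by (cases "v \<in> \<rho>") auto
    then show False
      using u(2) by simp
  qed
qed (use assms finite_subset_V in auto)

lemma coefficients_exist:
  obtains w :: "'v \<Rightarrow> real" where "w 0 = c" "w q = d" "\<And>i. i \<in> {1..N} \<Longrightarrow> w (a i) = A i"
    "\<And>i. i \<in> {1..N} \<Longrightarrow> w (b i) = B i" "\<And>v. v \<notin> V \<Longrightarrow> w v = 0"
proof -
  define w where "w v = (if v = 0 then c else if v = q then d
    else if v \<in> a ` {1..N} then A (inv_into {1..N} a v)
    else if v \<in> b ` {1..N} then B (inv_into {1..N} b v) else 0)" for v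
  have ab: "b i \<notin> a ` {1..N}" if "i \<in> {1..N}" for i
    using that by auto
  show thesis
  proof (rule that[of w])
    show "w (a i) = A i" if "i \<in> {1..N}" for i
      using that inj_ab by (simp add: w_def)
    show "w (b i) = B i" if "i \<in> {1..N}" for i
      using that ab[OF that] inj_ab by (simp add: w_def)
    show "w v = 0" if "v \<notin> V" for v
      using that unfolding w_def V_def by simp
  qed (simp_all add: w_def)
qed

text \<open>All vertical edges are translates of one vector \<open>d\<close>, so
  \<open>a i = b i + d\<close>. A combination thus depends only on the weight of \<open>q\<close>,
  the column weights and the total weight of the top.\<close>

lemma combination_eqI:
  assumes "u 0 = w 0" "u q = w q" "(\<Sum>i=1..N. u (a i)) = (\<Sum>i=1..N. w (a i))"
    and ab: "\<And>i. i \<in> {1..N} \<Longrightarrow> u (a i) + u (b i) = w (a i) + w (b i)"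
  shows "(\<Sum>v\<in>V. u v *\<^sub>R v) = (\<Sum>v\<in>V. w v *\<^sub>R v)" "sum u V = sum w V"
proof -
  define d where "d = a 1 - b 1"
  have d: "a i = b i + d" if "i \<in> {1..N}" for i
    using parallel[of i 1] that N_pos by (simp add: d_def algebra_simps)
  have *: "(\<Sum>v\<in>V. f v *\<^sub>R v) = f q *\<^sub>R q + (\<Sum>i=1..N. (f (a i) + f (b i)) *\<^sub>R b i) + (\<Sum>i=1..N. f (a i)) *\<^sub>R d"
    for f :: "'v \<Rightarrow> real"
  proof -
    have "(\<Sum>i=1..N. f (a i) *\<^sub>R a i) + (\<Sum>i=1..N. f (b i) *\<^sub>R b i)
      = (\<Sum>i=1..N. (f (a i) + f (b i)) *\<^sub>R b i + f (a i) *\<^sub>R d)"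
      unfolding sum.distrib[symmetric] by (intro sum.cong refl) (simp add: d algebra_simps)
    then show ?thesis
      by (simp add: sum_V sum.distrib scaleR_sum_left)
  qed
  have "(\<Sum>i=1..N. (u (a i) + u (b i)) *\<^sub>R b i) = (\<Sum>i=1..N. (w (a i) + w (b i)) *\<^sub>R b i)"
    by (intro sum.cong refl) (simp only: ab)
  then show "(\<Sum>v\<in>V. u v *\<^sub>R v) = (\<Sum>v\<in>V. w v *\<^sub>R v)"
    unfolding * using assms by simp
  have "(\<Sum>i=1..N. u (a i) + u (b i)) = (\<Sum>i=1..N. w (a i) + w (b i))"
    by (intro sum.cong refl) (simp only: ab)
  then have "(\<Sum>i=1..N. u (a i)) + (\<Sum>i=1..N. u (b i)) = (\<Sum>i=1..N. w (a i)) + (\<Sum>i=1..N. w (b i))"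
    by (simp only: sum.distrib)
  then show "sum u V = sum w V"
    using assms(1-3) by (simp add: sum_V)
qed

section \<open>The triangulation of a permutation\<close>

text \<open>A simplex of the staircase triangulation of a simplex times a segment: in the order
  \<pi>, the path runs along the top up to position \<open>k\<close>, descends there, and continues
  along the bottom. Column \<open>\<pi> k\<close> is the only full one.\<close>

definition staircase :: "(nat \<Rightarrow> nat) \<Rightarrow> nat \<Rightarrow> 'v set" where
  "staircase \<pi> k = {0, q} \<union> a ` \<pi> ` {1..k} \<union> b ` \<pi> ` {k..N}"

definition tri :: "(nat \<Rightarrow> nat) \<Rightarrow> 'v set set" where
  "tri \<pi> = staircase \<pi> ` {1..N}"

context
  fixes \<pi> assumes \<pi>: "\<pi> permutes {1..N}"
begin

lemma perm_in [simp]: "i \<in> {1..N} \<Longrightarrow> \<pi> i \<in> {1..N}"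
  using permutes_in_image[OF \<pi>] by blast

lemma perm_bounds [simp]: "\<lbrakk>Suc 0 \<le> i; i \<le> N\<rbrakk> \<Longrightarrow> Suc 0 \<le> \<pi> i" "\<lbrakk>Suc 0 \<le> i; i \<le> N\<rbrakk> \<Longrightarrow> \<pi> i \<le> N"
  using perm_in[of i] by simp_all

lemma perm_eq [simp]: "\<pi> i = \<pi> j \<longleftrightarrow> i = j"
  using permutes_inj[OF \<pi>] by (auto dest: injD)

lemma perm_cases:
  assumes "x \<in> {1..N}"
  obtains i where "i \<in> {1..N}" "x = \<pi> i"
  using assms permutes_image[OF \<pi>] by (metis imageE)

lemma zero_q_in_staircase [simp]: "0 \<in> staircase \<pi> k" "q \<in> staircase \<pi> k"
  by (auto simp: staircase_def)

lemma a_in_staircase [simp]: "\<lbrakk>i \<in> {1..N}; k \<in> {1..N}\<rbrakk> \<Longrightarrow> a (\<pi> i) \<in> staircase \<pi> k \<longleftrightarrow> i \<le> k"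
proof
  assume i: "i \<in> {1..N}" and k: "k \<in> {1..N}" and "a (\<pi> i) \<in> staircase \<pi> k"
  moreover have "a (\<pi> i) \<notin> {0, q}" "a (\<pi> i) \<noteq> b (\<pi> j)" if "j \<in> {k..N}" for j
    using that i k by auto
  ultimately have "a (\<pi> i) \<in> a ` \<pi> ` {1..k}"
    unfolding staircase_def using N_pos k by auto
  then obtain j where "j \<in> {1..k}" "a (\<pi> i) = a (\<pi> j)"
    by auto
  moreover have "j \<in> {1..N}"
    using calculation k by auto
  ultimately show "i \<le> k"
    using i by auto
next
  show "a (\<pi> i) \<in> staircase \<pi> k" if "i \<in> {1..N}" "i \<le> k"
    using that by (auto simp: staircase_def)
qed

lemma b_in_staircase [simp]: "\<lbrakk>i \<in> {1..N}; k \<in> {1..N}\<rbrakk> \<Longrightarrow> b (\<pi> i) \<in> staircase \<pi> k \<longleftrightarrow> k \<le> i"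
proof
  assume i: "i \<in> {1..N}" and k: "k \<in> {1..N}" and "b (\<pi> i) \<in> staircase \<pi> k"
  moreover have "b (\<pi> i) \<notin> {0, q}" "a (\<pi> j) \<noteq> b (\<pi> i)" if "j \<in> {1..k}" for j
    using that i k by auto
  ultimately have "b (\<pi> i) \<in> b ` \<pi> ` {k..N}"
    unfolding staircase_def using N_pos k by auto
  then obtain j where "j \<in> {k..N}" "b (\<pi> i) = b (\<pi> j)"
    by auto
  moreover have "j \<in> {1..N}"
    using calculation k by auto
  ultimately show "k \<le> i"
    using i by auto
next
  show "b (\<pi> i) \<in> staircase \<pi> k" if "i \<in> {1..N}" "k \<le> i"
    using that by (auto simp: staircase_def)
qed

lemma staircase_subset_V:
  assumes "k \<in> {1..N}" shows "staircase \<pi> k \<subseteq> V"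
proof -
  have "\<pi> ` {1..k} \<subseteq> {1..N}" "\<pi> ` {k..N} \<subseteq> {1..N}"
    using assms by auto
  then show ?thesis
    unfolding staircase_def V_def by blast
qed

lemma staircase_independent:
  assumes "k \<in> {1..N}" shows "\<not> affine_dependent (staircase \<pi> k)"
proof
  assume "affine_dependent (staircase \<pi> k)"
  then obtain x y where xy: "x \<in> {1..N}" "y \<in> {1..N}" "x \<noteq> y" "square x y \<subseteq> staircase \<pi> k"
    using affine_dependent_iff[OF staircase_subset_V[OF assms]] by blast
  obtain i where i: "i \<in> {1..N}" "x = \<pi> i"
    using xy(1) by (rule perm_cases)
  obtain j where j: "j \<in> {1..N}" "y = \<pi> j"
    using xy(2) by (rule perm_cases)
  show False
    using xy(3,4) i j assms by (simp add: square_def)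
qed

text \<open>Column \<open>\<pi> k\<close> supplies the vertical vector. Adding it to, or subtracting
  it from, the end present in another column produces the missing end.\<close>

lemma affine_hull_staircase:
  assumes k: "k \<in> {1..N}" shows "affine hull (staircase \<pi> k) = affine hull V"
proof
  show "affine hull (staircase \<pi> k) \<subseteq> affine hull V"
    using staircase_subset_V[OF k] by (rule hull_mono)
  have inc: "v \<in> affine hull (staircase \<pi> k)" if "v \<in> staircase \<pi> k" for v
    using that by (rule hull_inc)
  have "v \<in> affine hull (staircase \<pi> k)" if "v \<in> V" for v
    using that
  proof (cases v rule: V_cases)
    case (3 x)
    obtain i where i: "i \<in> {1..N}" "x = \<pi> i"
      using 3(1) by (rule perm_cases)
    show ?thesis
    proof (cases "i \<le> k")
      case False
      have "b (\<pi> i) + 1 *\<^sub>R (a (\<pi> k) - b (\<pi> k)) \<in> affine hull (staircase \<pi> k)"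
        using i k False by (intro mem_affine_3_minus inc affine_affine_hull) auto
      moreover have "a (\<pi> i) = b (\<pi> i) + 1 *\<^sub>R (a (\<pi> k) - b (\<pi> k))"
        using parallel[of "\<pi> i" "\<pi> k"] i k by (simp add: algebra_simps)
      ultimately show ?thesis
        using 3 i by simp
    qed (use inc 3 i k in auto)
  next
    case (4 x)
    obtain i where i: "i \<in> {1..N}" "x = \<pi> i"
      using 4(1) by (rule perm_cases)
    show ?thesis
    proof (cases "k \<le> i")
      case False
      have "a (\<pi> i) + 1 *\<^sub>R (b (\<pi> k) - a (\<pi> k)) \<in> affine hull (staircase \<pi> k)"
        using i k False by (intro mem_affine_3_minus inc affine_affine_hull) auto
      moreover have "b (\<pi> i) = a (\<pi> i) + 1 *\<^sub>R (b (\<pi> k) - a (\<pi> k))"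
        using parallel[of "\<pi> i" "\<pi> k"] i k by (simp add: algebra_simps)
      ultimately show ?thesis
        using 4 i by simp
    qed (use inc 4 i k in auto)
  qed (use inc in auto)
  then show "affine hull V \<subseteq> affine hull (staircase \<pi> k)"
    by (intro hull_minimal affine_affine_hull) auto
qed

text \<open>The top weight of the second representation dominates that of the first in every column:
  up to position \<open>k\<close> the second has no bottom vertex, hence the full column weight on
  top, and after \<open>k\<close> the first has no top vertex. Both have the same total on top, so
  they agree column by column and live on the common vertices.\<close>

lemma hull_Int_staircase_less:
  assumes k: "k \<in> {1..N}" and l: "l \<in> {1..N}" and "k < l"
  shows "convex hull (staircase \<pi> k) \<inter> convex hull (staircase \<pi> l) \<subseteq> convex hull (staircase \<pi> k \<inter> staircase \<pi> l)"
proof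
  fix x
  assume "x \<in> convex hull (staircase \<pi> k) \<inter> convex hull (staircase \<pi> l)"
  then have xk: "x \<in> convex hull (staircase \<pi> k)" and xl: "x \<in> convex hull (staircase \<pi> l)"
    by auto
  obtain u where u: "\<forall>v. 0 \<le> u v" "\<forall>v. v \<notin> staircase \<pi> k \<longrightarrow> u v = 0" "sum u V = 1" "(\<Sum>v\<in>V. u v *\<^sub>R v) = x"
    by (rule mem_convex_hullE[OF staircase_subset_V[OF k] xk])
  obtain w where w: "\<forall>v. 0 \<le> w v" "\<forall>v. v \<notin> staircase \<pi> l \<longrightarrow> w v = 0" "sum w V = 1" "(\<Sum>v\<in>V. w v *\<^sub>R v) = x"
    by (rule mem_convex_hullE[OF staircase_subset_V[OF l] xl])
  have eq: "(\<Sum>v\<in>V. u v *\<^sub>R v) = (\<Sum>v\<in>V. w v *\<^sub>R v)" "sum u V = sum w V"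
    using u w by simp_all
  note uw = combination_eqD[OF eq]
  have le: "u (a y) \<le> w (a y)" if y: "y \<in> {1..N}" for y
  proof -
    obtain i where i: "i \<in> {1..N}" "y = \<pi> i"
      using y by (rule perm_cases)
    show ?thesis
    proof (cases "i \<le> k")
      case True
      then have "w (b y) = 0"
        using w(2) i l \<open>k < l\<close> by simp
      then show ?thesis
        using uw(4)[OF y] u(1)[rule_format, of "b y"] by linarith
    next
      case False
      then have "u (a y) = 0"
        using u(2) i k by simp
      then show ?thesis
        using w(1) by simp
    qed
  qed
  have "(\<Sum>i=1..N. w (a i) - u (a i)) = 0"
    using uw(3) by (simp add: sum_subtractf)
  then have "\<forall>i\<in>{1..N}. w (a i) - u (a i) = 0"
    using le sum_nonneg_eq_0_iff[of "{1..N}" "\<lambda>i. w (a i) - u (a i)"] by simp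
  then have ab: "u (a i) = w (a i)" "u (b i) = w (b i)" if "i \<in> {1..N}" for i
    using uw(4)[OF that] that by auto
  have "u v = w v" for v
  proof (cases "v \<in> V")
    case True
    then show ?thesis
      using ab uw(1,2) by (cases v rule: V_cases) auto
  next
    case False
    then show ?thesis
      using u(2) w(2) staircase_subset_V[OF k] staircase_subset_V[OF l] by (metis subsetD)
  qed
  then have "\<forall>v. v \<notin> staircase \<pi> k \<inter> staircase \<pi> l \<longrightarrow> u v = 0"
    using u(2) w(2) by (metis IntI)
  moreover have "staircase \<pi> k \<inter> staircase \<pi> l \<subseteq> V"
    using staircase_subset_V[OF k] by blast
  ultimately show "x \<in> convex hull (staircase \<pi> k \<inter> staircase \<pi> l)"
    using u by (subst mem_convex_hull_iff) (auto intro!: exI[of _ u])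
qed

lemma hull_Int_staircase:
  assumes "k \<in> {1..N}" "l \<in> {1..N}"
  shows "convex hull (staircase \<pi> k) \<inter> convex hull (staircase \<pi> l) = convex hull (staircase \<pi> k \<inter> staircase \<pi> l)"
proof
  show "convex hull (staircase \<pi> k \<inter> staircase \<pi> l) \<subseteq> convex hull (staircase \<pi> k) \<inter> convex hull (staircase \<pi> l)"
    by (simp add: hull_mono)
  show "convex hull (staircase \<pi> k) \<inter> convex hull (staircase \<pi> l) \<subseteq> convex hull (staircase \<pi> k \<inter> staircase \<pi> l)"
    using hull_Int_staircase_less[of k l] hull_Int_staircase_less[of l k] assms
    by (cases k l rule: linorder_cases) (auto simp: Int_commute)
qed

text \<open>
  A point with coordinates \<open>c i\<close> and second coordinate \<open>\<tau>\<close> lies in the simplex whose index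
  is the first one at which the partial sums of \<open>c\<close>, taken in the order \<open>\<pi>\<close>, reach \<open>\<tau>\<close>.
\<close>

lemma staircase_cover:
  assumes "x \<in> convex hull V"
  shows "\<exists>k\<in>{1..N}. x \<in> convex hull (staircase \<pi> k)"
proof -
  obtain u where u: "\<forall>v. 0 \<le> u v" "\<forall>v. v \<notin> V \<longrightarrow> u v = 0" "sum u V = 1" "(\<Sum>v\<in>V. u v *\<^sub>R v) = x"
    by (rule mem_convex_hullE[OF subset_refl assms])
  define c where "c i = u (a (\<pi> i)) + u (b (\<pi> i))" for i
  define \<tau> where "\<tau> = (\<Sum>i=1..N. u (a i))"
  have reindex: "(\<Sum>i=1..N. f i) = (\<Sum>i=1..N. f (\<pi> i))" for f :: "nat \<Rightarrow> real"
    using sum.permute[OF \<pi>, of f] by (simp add: o_def)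
  have c: "0 \<le> c i" for i
    using u(1) by (simp add: c_def)
  have \<tau>: "0 \<le> \<tau>" "\<tau> \<le> (\<Sum>i=1..N. c i)"
    unfolding \<tau>_def reindex[of "\<lambda>i. u (a i)"] using u(1) by (auto simp: c_def intro!: sum_nonneg sum_mono)
  \<comment> \<open>The condition \<open>1 \<le> k\<close> keeps the index in range when \<tau> is
    0, where the empty sum would already suffice.\<close>
  define k where "k = (LEAST k. 1 \<le> k \<and> \<tau> \<le> (\<Sum>i=1..k. c i))"
  have k: "1 \<le> k" "\<tau> \<le> (\<Sum>i=1..k. c i)"
    using LeastI[of "\<lambda>k. 1 \<le> k \<and> \<tau> \<le> (\<Sum>i=1..k. c i)" N] \<tau> N_pos by (auto simp: k_def)
  have "k \<le> N"
    using Least_le[of "\<lambda>k. 1 \<le> k \<and> \<tau> \<le> (\<Sum>i=1..k. c i)" N] \<tau> N_pos by (auto simp: k_def)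
  then have kN: "k \<in> {1..N}"
    using k by simp
  have k': "(\<Sum>i=1..k-1. c i) \<le> \<tau>"
  proof (cases "k = 1")
    case False
    then have "\<not> (1 \<le> k - 1 \<and> \<tau> \<le> (\<Sum>i=1..k-1. c i))"
      using k(1) unfolding k_def by (intro not_less_Least) simp
    then show ?thesis
      using False k(1) by auto
  qed (use \<tau> in auto)
  define p where "p = inv_into UNIV \<pi>"
  have p [simp]: "p (\<pi> i) = i" for i
    unfolding p_def using permutes_inverses(2)[OF \<pi>] by blast
  \<comment> \<open>Greedy filling: the columns before \<open>k\<close> are moved entirely to the
    top, column \<open>k\<close> takes the rest of \<tau>, later ones nothing. The rest lies between
    0 and \<open>c k\<close> by the minimality of \<open>k\<close>.\<close>
  define A where "A i = (if i < k then c i else if i = k then \<tau> - (\<Sum>i=1..k-1. c i) else 0)" for i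
  obtain w :: "'v \<Rightarrow> real" where w: "w 0 = u 0" "w q = u q" "\<And>i. i \<in> {1..N} \<Longrightarrow> w (a i) = A (p i)"
    "\<And>i. i \<in> {1..N} \<Longrightarrow> w (b i) = c (p i) - A (p i)" "\<And>v. v \<notin> V \<Longrightarrow> w v = 0"
    using coefficients_exist[of "u 0" "u q" "\<lambda>i. A (p i)" "\<lambda>i. c (p i) - A (p i)"] by metis
  have split: "{1..k} = insert k {1..k-1}" "k \<notin> {1..k-1}"
    using k(1) by auto
  have "(\<Sum>i=1..k. c i) = c k + (\<Sum>i=1..k-1. c i)"
    unfolding split(1) using split(2) by simp
  then have A: "0 \<le> A i" "A i \<le> c i" for i
    using c[of i] k k' by (auto simp: A_def)
  have sum_A: "(\<Sum>i=1..N. A i) = \<tau>"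
  proof -
    have "(\<Sum>i=1..N. A i) = (\<Sum>i=1..k. A i)"
      using \<open>k \<le> N\<close> by (intro sum.mono_neutral_right) (auto simp: A_def)
    also have "\<dots> = A k + (\<Sum>i=1..k-1. A i)"
      unfolding split(1) using split(2) by simp
    also have "(\<Sum>i=1..k-1. A i) = (\<Sum>i=1..k-1. c i)"
      using k(1) by (intro sum.cong) (auto simp: A_def)
    finally show ?thesis
      by (simp add: A_def)
  qed
  have "(\<Sum>i=1..N. w (a i)) = (\<Sum>i=1..N. A (p i))"
    by (intro sum.cong refl) (simp only: w)
  also have "\<dots> = (\<Sum>i=1..N. u (a i))"
    unfolding reindex[of "\<lambda>i. A (p i)"] using sum_A by (simp add: \<tau>_def)
  finally have suma: "(\<Sum>i=1..N. w (a i)) = (\<Sum>i=1..N. u (a i))" .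
  have wab: "w (a i) + w (b i) = u (a i) + u (b i)" if "i \<in> {1..N}" for i
    using that by (rule perm_cases) (simp add: w c_def)
  have eq: "(\<Sum>v\<in>V. w v *\<^sub>R v) = x" "sum w V = 1"
    using combination_eqI[OF w(1,2) suma wab] u by simp_all
  have nonneg: "0 \<le> w v" for v
  proof (cases "v \<in> V")
    case True
    then show ?thesis
      using u(1) A by (cases v rule: V_cases) (simp_all add: w)
  qed (simp add: w)
  have zero: "w v = 0" if "v \<notin> staircase \<pi> k" for v
  proof (cases "v \<in> V")
    case True
    then show ?thesis
    proof (cases v rule: V_cases)
      case (3 y)
      obtain i where i: "i \<in> {1..N}" "y = \<pi> i"
        using 3(1) by (rule perm_cases)
      have "k < i"
        using that 3 i kN by (simp add: not_le)
      then show ?thesis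
        using 3 i by (simp add: w A_def)
    next
      case (4 y)
      obtain i where i: "i \<in> {1..N}" "y = \<pi> i"
        using 4(1) by (rule perm_cases)
      have "i < k"
        using that 4 i kN by (simp add: not_le)
      then show ?thesis
        using 4 i by (simp add: w A_def)
    qed (use that in auto)
  qed (simp add: w)
  have "x \<in> convex hull (staircase \<pi> k)"
    unfolding mem_convex_hull_iff[OF staircase_subset_V[OF kN]]
    using nonneg zero eq by (intro exI[of _ w]) simp
  then show ?thesis
    using kN by blast
qed

lemma tri_triangulation: "tri \<pi> \<in> polytope_triangulations (convex hull V)"
proof -
  have "(\<Union>\<sigma>\<in>tri \<pi>. convex hull \<sigma>) = convex hull V"
  proof
    show "convex hull V \<subseteq> (\<Union>\<sigma>\<in>tri \<pi>. convex hull \<sigma>)"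
      using staircase_cover by (auto simp: tri_def)
    show "(\<Union>\<sigma>\<in>tri \<pi>. convex hull \<sigma>) \<subseteq> convex hull V"
      unfolding tri_def by (auto dest!: subsetD[OF hull_mono[OF staircase_subset_V], rotated])
  qed
  moreover have "(convex hull \<sigma> \<inter> convex hull \<tau>) face_of (convex hull \<sigma>)"
    "(convex hull \<sigma> \<inter> convex hull \<tau>) face_of (convex hull \<tau>)" if "\<sigma> \<in> tri \<pi>" "\<tau> \<in> tri \<pi>" for \<sigma> \<tau>
  proof -
    obtain k l where kl: "k \<in> {1..N}" "\<sigma> = staircase \<pi> k" "l \<in> {1..N}" "\<tau> = staircase \<pi> l"
      using \<open>\<sigma> \<in> tri \<pi>\<close> \<open>\<tau> \<in> tri \<pi>\<close> unfolding tri_def by blast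
    show "(convex hull \<sigma> \<inter> convex hull \<tau>) face_of (convex hull \<sigma>)"
      "(convex hull \<sigma> \<inter> convex hull \<tau>) face_of (convex hull \<tau>)"
      unfolding kl hull_Int_staircase[OF kl(1,3)]
      by (intro simplex_face staircase_subset_V staircase_independent kl Int_lower1 Int_lower2)+
  qed
  moreover have "\<sigma> \<subseteq> V \<and> \<not> affine_dependent \<sigma> \<and> affine hull \<sigma> = affine hull V" if "\<sigma> \<in> tri \<pi>" for \<sigma>
    using that staircase_subset_V staircase_independent affine_hull_staircase unfolding tri_def by blast
  ultimately show ?thesis
    unfolding polytope_triangulations_def polytope_vertices_prism affine_hull_convex_hull
    by (intro CollectI conjI ballI) simp_all
qed

end

section \<open>Every triangulation comes from a permutation\<close>

definition A_of :: "'v set \<Rightarrow> nat set" where "A_of \<sigma> = {i \<in> {1..N}. a i \<in> \<sigma>}"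

definition B_of :: "'v set \<Rightarrow> nat set" where "B_of \<sigma> = {i \<in> {1..N}. b i \<in> \<sigma>}"

lemma A_of_B_of_finite [simp]: "finite (A_of \<sigma>)" "finite (B_of \<sigma>)"
  by (simp_all add: A_of_def B_of_def)

lemma A_of_subset: "A_of \<sigma> \<subseteq> {1..N}"
  by (auto simp: A_of_def)

lemma simplex_eq_A_of_B_of:
  assumes "\<sigma> \<subseteq> V" "0 \<in> \<sigma>" "q \<in> \<sigma>"
  shows "\<sigma> = {0, q} \<union> a ` A_of \<sigma> \<union> b ` B_of \<sigma>"
proof
  show "\<sigma> \<subseteq> {0, q} \<union> a ` A_of \<sigma> \<union> b ` B_of \<sigma>"
  proof
    fix v
    assume "v \<in> \<sigma>"
    then have "v \<in> V"
      using assms by blast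
    then show "v \<in> {0, q} \<union> a ` A_of \<sigma> \<union> b ` B_of \<sigma>"
      using \<open>v \<in> \<sigma>\<close> by (cases v rule: V_cases) (auto simp: A_of_def B_of_def)
  qed
qed (use assms in \<open>auto simp: A_of_def B_of_def\<close>)

text \<open>Every vertex is an affine combination of \<sigma>, and comparing weights shows what
  \<sigma> must contain: each apex is needed for itself, and \<open>a i\<close> needs a vertex in
  column \<open>i\<close>. Two full columns would contain a square; the absence of a full column is
  refuted by the missing end of column 1.\<close>

lemma spanning_simplex:
  assumes \<sigma>: "\<sigma> \<subseteq> V" "\<not> affine_dependent \<sigma>" "affine hull \<sigma> = affine hull V"
  shows "0 \<in> \<sigma>" "q \<in> \<sigma>" "A_of \<sigma> \<union> B_of \<sigma> = {1..N}" "\<exists>k. A_of \<sigma> \<inter> B_of \<sigma> = {k}"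
proof -
  have combination: "\<exists>u. (\<forall>w. w \<notin> \<sigma> \<longrightarrow> u w = 0) \<and> u 0 = of_bool (0 = v) \<and> u q = of_bool (q = v) \<and>
      (\<Sum>i=1..N. u (a i)) = (\<Sum>i=1..N. of_bool (a i = v)) \<and>
      (\<forall>i\<in>{1..N}. u (a i) + u (b i) = of_bool (a i = v) + (of_bool (b i = v) :: real))" if v: "v \<in> V" for v
  proof -
    have "v \<in> affine hull \<sigma>"
      using \<sigma>(3) v by (simp add: hull_inc)
    then obtain u where u: "\<forall>w. w \<notin> \<sigma> \<longrightarrow> u w = 0" "sum u V = 1" "(\<Sum>w\<in>V. u w *\<^sub>R w) = v"
      by (rule mem_affine_hullE[OF \<sigma>(1)])
    have eq: "(\<Sum>w\<in>V. u w *\<^sub>R w) = (\<Sum>w\<in>V. of_bool (w = v) *\<^sub>R w)" "sum u V = (\<Sum>w\<in>V. of_bool (w = v))"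
      unfolding vertex_combination[OF v] u by simp_all
    show ?thesis
      using u(1) combination_eqD[OF eq] by (intro exI[of _ u]) simp
  qed
  obtain u where "\<forall>w. w \<notin> \<sigma> \<longrightarrow> u w = 0" "u 0 = (1::real)"
    using combination[OF zero_in_V] by auto
  then show "0 \<in> \<sigma>"
    by (metis zero_neq_one)
  obtain u where "\<forall>w. w \<notin> \<sigma> \<longrightarrow> u w = 0" "u q = (1::real)"
    using combination[OF q_in_V] by auto
  then show "q \<in> \<sigma>"
    by (metis zero_neq_one)
  show AB: "A_of \<sigma> \<union> B_of \<sigma> = {1..N}"
  proof
    show "{1..N} \<subseteq> A_of \<sigma> \<union> B_of \<sigma>"
    proof
      fix i
      assume i: "i \<in> {1..N}"
      obtain u where u: "\<forall>w. w \<notin> \<sigma> \<longrightarrow> u w = 0"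
        "\<forall>j\<in>{1..N}. u (a j) + u (b j) = of_bool (a j = a i) + (of_bool (b j = a i) :: real)"
        using combination[OF a_in_V[OF i]] by blast
      then have "u (a i) + u (b i) = 1"
        using i by simp
      with u(1) have "a i \<in> \<sigma> \<or> b i \<in> \<sigma>"
        by (metis add_0 zero_neq_one)
      then show "i \<in> A_of \<sigma> \<union> B_of \<sigma>"
        using i by (auto simp: A_of_def B_of_def)
    qed
  qed (auto simp: A_of_def B_of_def)
  have "A_of \<sigma> \<inter> B_of \<sigma> \<noteq> {}"
  proof
    assume disj: "A_of \<sigma> \<inter> B_of \<sigma> = {}"
    have one: "a i \<notin> \<sigma> \<or> b i \<notin> \<sigma>" if "i \<in> {1..N}" for i
      using disj that by (auto simp: A_of_def B_of_def)
    have 1: "1 \<in> {1..N}"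
      using N_pos by simp
    \<comment> \<open>With one vertex per column, a column of weight zero carries no weight at all.
      In a representation of either end of column 1, the total top weight is therefore that of
      \<open>a 1\<close>, and it has the wrong value for the end that \<sigma> lacks.\<close>
    have others: "(\<Sum>j=1..N. u (a j)) = u (a 1)"
      if u: "\<forall>w. w \<notin> \<sigma> \<longrightarrow> u w = 0" "\<forall>i\<in>{1..N}. i \<noteq> 1 \<longrightarrow> u (a i) + u (b i) = 0" for u :: "'v \<Rightarrow> real"
    proof -
      have "u (a j) = 0" if "j \<in> {1..N} - {1}" for j
        using one[of j] u that by force
      then have "(\<Sum>j=1..N. u (a j)) = (\<Sum>j\<in>{1}. u (a j))"
        using 1 by (intro sum.mono_neutral_right) auto
      then show ?thesis
        by simp
    qed
    show False
    proof (cases "a 1 \<in> \<sigma>")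
      case True
      then have b1: "b 1 \<notin> \<sigma>"
        using one[OF 1] by blast
      obtain u where u: "\<forall>w. w \<notin> \<sigma> \<longrightarrow> u w = 0" "(\<Sum>i=1..N. u (a i)) = (\<Sum>i=1..N. of_bool (a i = b 1))"
        "\<forall>i\<in>{1..N}. u (a i) + u (b i) = of_bool (a i = b 1) + (of_bool (b i = b 1) :: real)"
        using combination[OF b_in_V[OF 1]] by blast
      have "(\<Sum>i=1..N. u (a i)) = u (a 1)"
        using u(1,3) 1 by (intro others) auto
      moreover have "u (a 1) = 1"
        using u(1,3) b1 1 by force
      moreover have "(\<Sum>i=1..N. of_bool (a i = b 1)) = (0::real)"
        using 1 by (intro sum.neutral) auto
      ultimately show False
        using u(2) by simp
    next
      case False
      obtain u where u: "\<forall>w. w \<notin> \<sigma> \<longrightarrow> u w = 0" "(\<Sum>i=1..N. u (a i)) = (\<Sum>i=1..N. of_bool (a i = a 1))"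
        "\<forall>i\<in>{1..N}. u (a i) + u (b i) = of_bool (a i = a 1) + (of_bool (b i = a 1) :: real)"
        using combination[OF a_in_V[OF 1]] by blast
      have "(\<Sum>i=1..N. u (a i)) = u (a 1)"
        using u(1,3) 1 by (intro others) auto
      moreover have "u (a 1) = 0"
        using u(1) False by blast
      moreover have "(\<Sum>i=1..N. of_bool (a i = a 1)) = (\<Sum>i\<in>{1}. of_bool (a i = a 1) :: real)"
        using 1 by (intro sum.mono_neutral_right) auto
      ultimately show False
        using u(2) by simp
    qed
  qed
  moreover have "i = j" if "i \<in> A_of \<sigma> \<inter> B_of \<sigma>" "j \<in> A_of \<sigma> \<inter> B_of \<sigma>" for i j
  proof (rule ccontr)
    assume "i \<noteq> j"
    moreover have "i \<in> {1..N}" "j \<in> {1..N}" "square i j \<subseteq> \<sigma>"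
      using that by (auto simp: A_of_def B_of_def square_def)
    ultimately show False
      using affine_dependent_iff[OF \<sigma>(1)] \<sigma>(2) by blast
  qed
  ultimately show "\<exists>k. A_of \<sigma> \<inter> B_of \<sigma> = {k}"
    by blast
qed

context
  fixes T assumes T: "T \<in> polytope_triangulations (convex hull V)"
begin

lemma triangulation_simplex:
  assumes "\<sigma> \<in> T"
  shows "\<sigma> \<subseteq> V" "\<not> affine_dependent \<sigma>" "affine hull \<sigma> = affine hull V"
  using T assms by (auto simp: polytope_triangulations_def polytope_vertices_prism)

lemma triangulation_A_of_B_of:
  assumes "\<sigma> \<in> T"
  shows "A_of \<sigma> \<union> B_of \<sigma> = {1..N}" "\<exists>k. A_of \<sigma> \<inter> B_of \<sigma> = {k}"
    "\<sigma> = {0, q} \<union> a ` A_of \<sigma> \<union> b ` B_of \<sigma>"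
  using spanning_simplex[OF triangulation_simplex[OF assms]]
    simplex_eq_A_of_B_of[OF triangulation_simplex(1)[OF assms]] by simp_all

text \<open>
  The midpoint of \<open>a i\<close> and \<open>b j\<close> is that of \<open>a j\<close> and \<open>b i\<close>, so it would lie in a common face
  containing all four points.
\<close>

lemma compatible:
  assumes "\<sigma> \<in> T" "\<tau> \<in> T" "i \<in> A_of \<sigma>" "j \<in> B_of \<sigma>" "j \<in> A_of \<tau>" "i \<in> B_of \<tau>"
  shows "i = j"
proof (rule ccontr)
  assume "i \<noteq> j"
  have ij: "i \<in> {1..N}" "j \<in> {1..N}" "a i \<in> \<sigma>" "b j \<in> \<sigma>" "a j \<in> \<tau>" "b i \<in> \<tau>"
    using assms by (auto simp: A_of_def B_of_def)
  define x where "x = midpoint (a i) (b j)"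
  have "x = midpoint (a j) (b i)"
    using parallel[OF ij(1,2)] by (simp add: x_def midpoint_def)
  then have x\<tau>: "x \<in> convex hull \<tau>"
    using ij closed_segment_subset_convex_hull[of "a j" \<tau> "b i"] by (auto simp: hull_inc)
  have x\<sigma>: "x \<in> convex hull \<sigma>"
    using ij closed_segment_subset_convex_hull[of "a i" \<sigma> "b j"] by (auto simp: x_def hull_inc)
  have "(convex hull \<sigma> \<inter> convex hull \<tau>) face_of (convex hull \<sigma>)"
    using T assms(1,2) by (auto simp: polytope_triangulations_def)
  moreover have "x \<in> open_segment (a i) (b j)"
    using ij by (simp add: x_def)
  moreover have "a i \<in> convex hull \<sigma>" "b j \<in> convex hull \<sigma>"
    using ij by (auto simp: hull_inc)
  ultimately have "a i \<in> convex hull \<tau>" "b j \<in> convex hull \<tau>"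
    using x\<sigma> x\<tau> face_ofD by blast+
  then have "a i \<in> \<tau>" "b j \<in> \<tau>"
    using mem_simplex_if_mem_hull[OF a_in_V[OF ij(1)] triangulation_simplex(1)[OF assms(2)]]
      mem_simplex_if_mem_hull[OF b_in_V[OF ij(2)] triangulation_simplex(1)[OF assms(2)]] by blast+
  then have "square i j \<subseteq> \<tau>"
    using ij by (simp add: square_def)
  then show False
    using \<open>i \<noteq> j\<close> ij affine_dependent_iff triangulation_simplex(1,2)[OF assms(2)] by blast
qed

lemma card_A_of:
  assumes "\<sigma> \<in> T"
  shows "card (A_of \<sigma>) \<in> {1..N}" "card (A_of \<sigma>) + card (B_of \<sigma>) = N + 1"
proof -
  obtain k where k: "A_of \<sigma> \<inter> B_of \<sigma> = {k}"
    using triangulation_A_of_B_of[OF assms] by blast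
  then show *: "card (A_of \<sigma>) + card (B_of \<sigma>) = N + 1"
    using card_Un_Int[of "A_of \<sigma>" "B_of \<sigma>"] triangulation_A_of_B_of(1)[OF assms] by simp
  have "A_of \<sigma> \<noteq> {}" "B_of \<sigma> \<noteq> {}"
    using k by auto
  then have "0 < card (A_of \<sigma>)" "0 < card (B_of \<sigma>)"
    by (simp_all add: card_gt_0_iff)
  then show "card (A_of \<sigma>) \<in> {1..N}"
    using * by auto
qed

text \<open>If the inclusion failed, cardinality would give indices in both differences. Since each
  column is met, each of the two lies in the opposite index set of the other simplex, which
  \<open>compatible\<close> forbids for distinct indices.\<close>

lemma A_of_mono:
  assumes \<sigma>: "\<sigma> \<in> T" and \<tau>: "\<tau> \<in> T" and "card (A_of \<sigma>) \<le> card (A_of \<tau>)"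
  shows "A_of \<sigma> \<subseteq> A_of \<tau>" "B_of \<tau> \<subseteq> B_of \<sigma>"
proof -
  note AB = triangulation_A_of_B_of(1)[OF \<sigma>] triangulation_A_of_B_of(1)[OF \<tau>]
  have "card (B_of \<tau>) \<le> card (B_of \<sigma>)"
    using card_A_of(2)[OF \<sigma>] card_A_of(2)[OF \<tau>] assms(3) by linarith
  show "A_of \<sigma> \<subseteq> A_of \<tau>"
  proof (rule ccontr)
    assume "\<not> A_of \<sigma> \<subseteq> A_of \<tau>"
    then obtain i where i: "i \<in> A_of \<sigma>" "i \<notin> A_of \<tau>"
      by blast
    have "\<not> A_of \<tau> \<subset> A_of \<sigma>"
      using assms(3) psubset_card_mono[of "A_of \<sigma>" "A_of \<tau>"] by auto
    then obtain j where j: "j \<in> A_of \<tau>" "j \<notin> A_of \<sigma>"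
      using i by blast
    have "i \<in> B_of \<tau>" "j \<in> B_of \<sigma>"
      using AB i j by auto
    then show False
      using compatible[OF \<sigma> \<tau>] i j by blast
  qed
  show "B_of \<tau> \<subseteq> B_of \<sigma>"
  proof (rule ccontr)
    assume "\<not> B_of \<tau> \<subseteq> B_of \<sigma>"
    then obtain i where i: "i \<in> B_of \<tau>" "i \<notin> B_of \<sigma>"
      by blast
    have "\<not> B_of \<sigma> \<subset> B_of \<tau>"
      using \<open>card (B_of \<tau>) \<le> card (B_of \<sigma>)\<close> psubset_card_mono[of "B_of \<tau>" "B_of \<sigma>"] by auto
    then obtain j where j: "j \<in> B_of \<sigma>" "j \<notin> B_of \<tau>"
      using i by blast
    have "i \<in> A_of \<sigma>" "j \<in> A_of \<tau>"
      using AB i j by auto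
    then show False
      using compatible[OF \<sigma> \<tau>] i j by blast
  qed
qed

lemma simplex_eqI:
  assumes "\<sigma> \<in> T" "\<tau> \<in> T" "card (A_of \<sigma>) = card (A_of \<tau>)"
  shows "\<sigma> = \<tau>"
proof -
  have "A_of \<sigma> = A_of \<tau>" "B_of \<sigma> = B_of \<tau>"
    by (intro subset_antisym A_of_mono assms eq_refl assms(3)[symmetric])+
  then show ?thesis
    using triangulation_A_of_B_of(3)[OF assms(1)] triangulation_A_of_B_of(3)[OF assms(2)] by simp
qed

text \<open>
  The point with all coordinates \<open>s i\<close> equal to \<open>1/N\<close> and with \<open>t = (m - 1/2)/N\<close> lies only in
  simplices that contain exactly \<open>m\<close> of the vertices \<open>a i\<close>.
\<close>

lemma simplex_with_card:
  assumes m: "m \<in> {1..N}"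
  shows "\<exists>\<sigma>\<in>T. card (A_of \<sigma>) = m"
proof -
  define \<theta> where "\<theta> = (real m - 1/2) / N"
  have \<theta>: "0 \<le> \<theta>" "\<theta> \<le> 1" "N * \<theta> = real m - 1/2"
    using m by (auto simp: \<theta>_def field_simps)
  obtain u :: "'v \<Rightarrow> real" where u: "u 0 = 0" "u q = 0" "\<And>i. i \<in> {1..N} \<Longrightarrow> u (a i) = \<theta> / N"
    "\<And>i. i \<in> {1..N} \<Longrightarrow> u (b i) = (1 - \<theta>) / N" "\<And>v. v \<notin> V \<Longrightarrow> u v = 0"
    using coefficients_exist[of 0 0 "\<lambda>_. \<theta> / N" "\<lambda>_. (1 - \<theta>) / N"] by metis
  define x where "x = (\<Sum>v\<in>V. u v *\<^sub>R v)"
  have u_sum: "sum u V = 1" "(\<Sum>i=1..N. u (a i)) = \<theta>"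
    using N_pos by (simp_all add: sum_V u field_simps)
  have "0 \<le> u v" for v
  proof (cases "v \<in> V")
    case True
    then show ?thesis
      using \<theta> by (cases v rule: V_cases) (simp_all add: u)
  qed (simp add: u)
  then have "x \<in> convex hull V"
    unfolding mem_convex_hull_iff[OF subset_refl] using u u_sum by (intro exI[of _ u]) (simp add: x_def)
  moreover have "(\<Union>\<sigma>\<in>T. convex hull \<sigma>) = convex hull V"
    using T by (simp add: polytope_triangulations_def)
  ultimately obtain \<sigma> where \<sigma>: "\<sigma> \<in> T" "x \<in> convex hull \<sigma>"
    by blast
  obtain w where w: "\<forall>v. 0 \<le> w v" "\<forall>v. v \<notin> \<sigma> \<longrightarrow> w v = 0" "sum w V = 1" "(\<Sum>v\<in>V. w v *\<^sub>R v) = x"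
    by (rule mem_convex_hullE[OF triangulation_simplex(1)[OF \<sigma>(1)] \<sigma>(2)])
  have eq: "(\<Sum>v\<in>V. w v *\<^sub>R v) = (\<Sum>v\<in>V. u v *\<^sub>R v)" "sum w V = sum u V"
    using w u_sum by (simp_all add: x_def)
  note wu = combination_eqD[OF eq]
  have wab: "w (a i) + w (b i) = 1 / N" if "i \<in> {1..N}" for i
    using wu(4)[OF that] u(3,4)[OF that] by (simp add: diff_divide_distrib)
  obtain k where k: "A_of \<sigma> \<inter> B_of \<sigma> = {k}"
    using triangulation_A_of_B_of(2)[OF \<sigma>(1)] by blast
  have kI: "k \<in> {1..N}" "k \<in> A_of \<sigma>"
    using k by (auto simp: A_of_def)
  have wk: "0 \<le> w (a k)" "w (a k) \<le> 1 / N"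
    using w(1)[rule_format, of "a k"] w(1)[rule_format, of "b k"] wab[OF kI(1)] by linarith+
  have "\<theta> = (\<Sum>i=1..N. w (a i))"
    using wu(3) u_sum(2) by simp
  also have "\<dots> = (\<Sum>i\<in>A_of \<sigma>. w (a i))"
    using w(2) by (intro sum.mono_neutral_right) (auto simp: A_of_def)
  also have "\<dots> = w (a k) + (\<Sum>i\<in>A_of \<sigma> - {k}. w (a i))"
    using kI by (simp add: sum.remove)
  also have "(\<Sum>i\<in>A_of \<sigma> - {k}. w (a i)) = (\<Sum>i\<in>A_of \<sigma> - {k}. 1 / N)"
  proof (rule sum.cong)
    fix i
    assume i: "i \<in> A_of \<sigma> - {k}"
    then have "i \<in> {1..N}" "i \<notin> B_of \<sigma>"
      using k by (auto simp: A_of_def)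
    then have "w (b i) = 0"
      using w(2) by (simp add: B_of_def)
    then show "w (a i) = 1 / N"
      using wab[OF \<open>i \<in> {1..N}\<close>] by simp
  qed simp
  also have "\<dots> = (real (card (A_of \<sigma>)) - 1) / N"
    using kI card_A_of(1)[OF \<sigma>(1)] by (simp add: of_nat_diff)
  finally have "N * \<theta> = N * w (a k) + (real (card (A_of \<sigma>)) - 1)"
    using N_pos by (simp add: field_simps)
  moreover have "0 \<le> N * w (a k)" "N * w (a k) \<le> 1"
    using wk N_pos by (simp_all add: field_simps)
  \<comment> \<open>The value \<open>m - 1/2\<close> lies strictly between consecutive integers, so
    only one cardinality fits the two bounds.\<close>
  ultimately have "real m - 1/2 \<le> real (card (A_of \<sigma>))" "real (card (A_of \<sigma>)) - 1 \<le> real m - 1/2"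
    using \<theta>(3) by linarith+
  then have "card (A_of \<sigma>) = m"
    by linarith
  then show ?thesis
    using \<sigma>(1) by blast
qed

text \<open>Each cardinality from 1 to \<open>N\<close> occurs, and only once by
  \<open>simplex_eqI\<close>, so the simplices are ranked by it. The permutation sends
  \<open>m\<close> to the full column of the simplex of rank \<open>m\<close>.\<close>

lemma triangulation_eq_tri: "\<exists>\<pi>. \<pi> permutes {1..N} \<and> T = tri \<pi>"
proof -
  obtain \<sigma> where \<sigma>: "\<And>m. m \<in> {1..N} \<Longrightarrow> \<sigma> m \<in> T" "\<And>m. m \<in> {1..N} \<Longrightarrow> card (A_of (\<sigma> m)) = m"
    using simplex_with_card by metis
  \<comment> \<open>The value \<open>m\<close> outside the index range makes the function the
    identity there, as \<open>permutes\<close> demands.\<close>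
  define \<pi> where "\<pi> m = (if m \<in> {1..N} then THE k. A_of (\<sigma> m) \<inter> B_of (\<sigma> m) = {k} else m)" for m
  have \<pi>: "A_of (\<sigma> m) \<inter> B_of (\<sigma> m) = {\<pi> m}" if m: "m \<in> {1..N}" for m
  proof -
    obtain k where "A_of (\<sigma> m) \<inter> B_of (\<sigma> m) = {k}"
      using triangulation_A_of_B_of(2)[OF \<sigma>(1)[OF m]] by blast
    then show ?thesis
      using m by (simp add: \<pi>_def)
  qed
  have A: "A_of (\<sigma> m) = \<pi> ` {1..m}" if "m \<in> {1..N}" for m
    using that
  proof (induction m)
    case (Suc m)
    show ?case
    proof (cases "m = 0")
      case True
      have "card (A_of (\<sigma> 1)) = 1" "\<pi> 1 \<in> A_of (\<sigma> 1)"
        using \<sigma>(2)[of 1] \<pi>[of 1] N_pos by auto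
      then show ?thesis
        using True by (auto simp: card_1_singleton_iff)
    next
      case False
      then have m: "m \<in> {1..N}" and A: "A_of (\<sigma> m) = \<pi> ` {1..m}"
        using Suc by auto
      have sub: "A_of (\<sigma> m) \<subseteq> A_of (\<sigma> (Suc m))"
        using A_of_mono(1)[OF \<sigma>(1)[OF m] \<sigma>(1)[OF Suc.prems]] \<sigma>(2)[OF m] \<sigma>(2)[OF Suc.prems] by simp
      then have "card (A_of (\<sigma> (Suc m)) - A_of (\<sigma> m)) = 1"
        using \<sigma>(2)[OF m] \<sigma>(2)[OF Suc.prems] by (simp add: card_Diff_subset)
      then obtain j where j: "A_of (\<sigma> (Suc m)) - A_of (\<sigma> m) = {j}"
        by (auto simp: card_1_singleton_iff)
      have jB: "j \<in> B_of (\<sigma> m)"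
        using j triangulation_A_of_B_of(1)[OF \<sigma>(1)[OF m]] A_of_subset[of "\<sigma> (Suc m)"] by blast
      \<comment> \<open>The index gained at rank \<open>m + 1\<close> is the full column of that
        rank. Otherwise the full column is already on top at rank \<open>m\<close> and still at the
        bottom at rank \<open>m + 1\<close>, while \<open>j\<close> is at the bottom before and on
        top after, contrary to \<open>compatible\<close>.\<close>
      have "\<pi> (Suc m) = j"
      proof (rule ccontr)
        assume "\<pi> (Suc m) \<noteq> j"
        then have "\<pi> (Suc m) \<in> A_of (\<sigma> m)" "\<pi> (Suc m) \<in> B_of (\<sigma> (Suc m))"
          using \<pi>[OF Suc.prems] j by auto
        then show False
          using compatible[OF \<sigma>(1)[OF m] \<sigma>(1)[OF Suc.prems] _ jB] j \<open>\<pi> (Suc m) \<noteq> j\<close> by blast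
      qed
      then have "A_of (\<sigma> (Suc m)) = insert (\<pi> (Suc m)) (\<pi> ` {1..m})"
        using j sub A by blast
      also have "\<dots> = \<pi> ` {1..Suc m}"
        by (simp add: atLeastAtMostSuc_conv)
      finally show ?thesis .
    qed
  qed simp
  have N: "N \<in> {1..N}"
    using N_pos by simp
  have "A_of (\<sigma> N) = {1..N}"
    using \<sigma>(2)[OF N] by (intro card_subset_eq) (auto simp: A_of_def)
  then have img: "\<pi> ` {1..N} = {1..N}"
    using A[OF N] by simp
  then have inj: "inj_on \<pi> {1..N}"
    by (intro eq_card_imp_inj_on) simp_all
  have perm: "\<pi> permutes {1..N}"
    using inj img by (intro bij_imp_permutes) (auto simp: bij_betw_def \<pi>_def)
  have B: "B_of (\<sigma> m) = \<pi> ` {m..N}" if m: "m \<in> {1..N}" for m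
  proof -
    have "B_of (\<sigma> m) = ({1..N} - A_of (\<sigma> m)) \<union> {\<pi> m}"
      using triangulation_A_of_B_of(1)[OF \<sigma>(1)[OF m]] \<pi>[OF m] by blast
    also have "{1..N} - A_of (\<sigma> m) = \<pi> ` ({1..N} - {1..m})"
      using m inj by (subst A[OF m], subst img[symmetric], intro inj_on_image_set_diff[symmetric]) auto
    also have "\<pi> ` ({1..N} - {1..m}) \<union> {\<pi> m} = \<pi> ` (({1..N} - {1..m}) \<union> {m})"
      by auto
    also have "({1..N} - {1..m}) \<union> {m} = {m..N}"
      using m by auto
    finally show ?thesis .
  qed
  have staircase: "\<sigma> m = staircase \<pi> m" if m: "m \<in> {1..N}" for m
    using triangulation_A_of_B_of(3)[OF \<sigma>(1)[OF m]] by (simp add: A[OF m] B[OF m] staircase_def)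
  have "T = tri \<pi>"
  proof
    show "tri \<pi> \<subseteq> T"
      using \<sigma>(1) staircase by (auto simp: tri_def)
    show "T \<subseteq> tri \<pi>"
    proof
      fix \<tau>
      assume \<tau>: "\<tau> \<in> T"
      let ?m = "card (A_of \<tau>)"
      have m: "?m \<in> {1..N}"
        by (rule card_A_of(1)[OF \<tau>])
      have "\<tau> = \<sigma> ?m"
        using \<sigma>(1)[OF m] \<sigma>(2)[OF m] \<tau> by (intro simplex_eqI) auto
      then show "\<tau> \<in> tri \<pi>"
        using staircase[OF m] m by (auto simp: tri_def)
    qed
  qed
  then show ?thesis
    using perm by blast
qed

end

section \<open>Recovering the permutation from its triangulation\<close>

lemma A_of_B_of_staircase:
  assumes \<pi>: "\<pi> permutes {1..N}" and k: "k \<in> {1..N}"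
  shows "A_of (staircase \<pi> k) = \<pi> ` {1..k}" "B_of (staircase \<pi> k) = \<pi> ` {k..N}"
proof -
  have "x \<in> A_of (staircase \<pi> k) \<longleftrightarrow> x \<in> \<pi> ` {1..k}" "x \<in> B_of (staircase \<pi> k) \<longleftrightarrow> x \<in> \<pi> ` {k..N}" for x
  proof -
    have "x \<in> {1..N}" if "x \<in> \<pi> ` {1..k} \<or> x \<in> \<pi> ` {k..N}"
      using that k \<pi> by auto
    moreover have "x \<in> A_of (staircase \<pi> k) \<longleftrightarrow> x \<in> \<pi> ` {1..k}" "x \<in> B_of (staircase \<pi> k) \<longleftrightarrow> x \<in> \<pi> ` {k..N}" if "x \<in> {1..N}"
    proof -
      obtain i where i: "i \<in> {1..N}" "x = \<pi> i"
        using \<open>x \<in> {1..N}\<close> by (rule perm_cases[OF \<pi>])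
      then show "x \<in> A_of (staircase \<pi> k) \<longleftrightarrow> x \<in> \<pi> ` {1..k}" "x \<in> B_of (staircase \<pi> k) \<longleftrightarrow> x \<in> \<pi> ` {k..N}"
        using k \<pi> by (auto simp: A_of_def B_of_def image_iff perm_eq[OF \<pi>] a_in_staircase[OF \<pi>] b_in_staircase[OF \<pi>] perm_bounds[OF \<pi>])
    qed
    ultimately show "x \<in> A_of (staircase \<pi> k) \<longleftrightarrow> x \<in> \<pi> ` {1..k}" "x \<in> B_of (staircase \<pi> k) \<longleftrightarrow> x \<in> \<pi> ` {k..N}"
      by (auto simp: A_of_def B_of_def)
  qed
  then show "A_of (staircase \<pi> k) = \<pi> ` {1..k}" "B_of (staircase \<pi> k) = \<pi> ` {k..N}"
    by blast+
qed

lemma card_A_of_staircase: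
  assumes \<pi>: "\<pi> permutes {1..N}" and k: "k \<in> {1..N}"
  shows "card (A_of (staircase \<pi> k)) = k"
  using A_of_B_of_staircase[OF assms] permutes_inj_on[OF \<pi>] by (simp add: card_image)

lemma A_of_Int_B_of_staircase:
  assumes \<pi>: "\<pi> permutes {1..N}" and k: "k \<in> {1..N}"
  shows "A_of (staircase \<pi> k) \<inter> B_of (staircase \<pi> k) = {\<pi> k}"
  unfolding A_of_B_of_staircase[OF assms] using k by (auto simp: perm_eq[OF \<pi>])

text \<open>A staircase reveals its position as its number of top vertices, and the value of the
  permutation there as its full column.\<close>

lemma inj_on_tri: "inj_on tri {\<pi>. \<pi> permutes {1..N}}"
proof (rule inj_onI, simp only: mem_Collect_eq)
  fix \<pi> \<rho>
  assume \<pi>: "\<pi> permutes {1..N}" and \<rho>: "\<rho> permutes {1..N}" and eq: "tri \<pi> = tri \<rho>"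
  have "\<pi> k = \<rho> k" if k: "k \<in> {1..N}" for k
  proof -
    have "staircase \<pi> k \<in> tri \<pi>"
      using k by (auto simp: tri_def)
    then have "staircase \<pi> k \<in> tri \<rho>"
      using eq by simp
    then obtain l where l: "l \<in> {1..N}" "staircase \<pi> k = staircase \<rho> l"
      by (auto simp: tri_def)
    then have "k = l"
      using card_A_of_staircase[OF \<pi> k] card_A_of_staircase[OF \<rho> l(1)] by simp
    then show ?thesis
      using A_of_Int_B_of_staircase[OF \<pi> k] A_of_Int_B_of_staircase[OF \<rho> l(1)] l(2) by simp
  qed
  then show "\<pi> = \<rho>"
    using permutes_not_in[OF \<pi>] permutes_not_in[OF \<rho>] by (metis ext)
qed

lemma bij_betw_tri: "bij_betw tri {\<pi>. \<pi> permutes {1..N}} (polytope_triangulations (convex hull V))"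
  unfolding bij_betw_def using inj_on_tri tri_triangulation triangulation_eq_tri by blast

end

section \<open>Flips\<close>

lemma complex_of_Un: "complex_of (T \<union> T') = complex_of T \<union> complex_of T'"
  by (auto simp: complex_of_def)

lemma complex_of_mono:
  assumes "\<And>\<sigma>. \<sigma> \<in> S \<Longrightarrow> \<exists>\<tau>\<in>T. \<sigma> \<subseteq> \<tau>"
  shows "complex_of S \<subseteq> complex_of T"
proof
  fix \<rho>
  assume "\<rho> \<in> complex_of S"
  then obtain \<sigma> where "\<sigma> \<in> S" "\<rho> \<subseteq> \<sigma>"
    by (auto simp: complex_of_def)
  then show "\<rho> \<in> complex_of T"
    using assms[of \<sigma>] by (auto simp: complex_of_def)
qed

lemma circuit_triangulation_doubleton: "circuit_triangulation Z {y, z} = {Z - {y}, Z - {z}}"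
  by (auto simp: circuit_triangulation_def)

text \<open>A join with a full simplex on \<open>W\<close> adds \<open>W\<close> to every facet.
  This turns the joins in a flip into complexes with explicit facets.\<close>

lemma complex_join_Pow: "complex_join (complex_of T) (Pow W) = complex_of ((\<union>) W ` T)"
proof
  show "complex_join (complex_of T) (Pow W) \<subseteq> complex_of ((\<union>) W ` T)"
  proof
    fix \<phi>
    assume "\<phi> \<in> complex_join (complex_of T) (Pow W)"
    then obtain \<sigma> \<rho> \<tau> where "\<phi> = \<rho> \<union> \<tau>" "\<sigma> \<in> T" "\<rho> \<subseteq> \<sigma>" "\<tau> \<subseteq> W"
      by (auto simp: complex_join_def complex_of_def)
    then have "W \<union> \<sigma> \<in> (\<union>) W ` T" "\<phi> \<subseteq> W \<union> \<sigma>"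
      by auto
    then show "\<phi> \<in> complex_of ((\<union>) W ` T)"
      unfolding complex_of_def by blast
  qed
  show "complex_of ((\<union>) W ` T) \<subseteq> complex_join (complex_of T) (Pow W)"
  proof
    fix \<phi>
    assume "\<phi> \<in> complex_of ((\<union>) W ` T)"
    then obtain \<sigma> where \<sigma>: "\<sigma> \<in> T" "\<phi> \<subseteq> W \<union> \<sigma>"
      by (auto simp: complex_of_def)
    then have "\<phi> \<inter> \<sigma> \<in> complex_of T" "\<phi> \<inter> W \<in> Pow W" "\<phi> = (\<phi> \<inter> \<sigma>) \<union> (\<phi> \<inter> W)"
      by (auto simp: complex_of_def)
    then show "\<phi> \<in> complex_join (complex_of T) (Pow W)"
      unfolding complex_join_def by blast
  qed
qed

context prism
begin

section \<open>Oriented circuits and links of faces\<close>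

lemma square_commute: "square x y = square y x"
  by (auto simp: square_def)

lemma square_Diff:
  assumes "x \<in> {1..N}" "y \<in> {1..N}" "x \<noteq> y"
  shows "square x y - {a y} = {a x, b x, b y}" "square x y - {b x} = {a x, a y, b y}"
    "square x y - {a x} = {a y, b x, b y}" "square x y - {b y} = {a x, a y, b x}"
  using assms by (auto simp: square_def)

lemma a_in_square:
  assumes "i \<in> {1..N}" "x \<in> {1..N}" "y \<in> {1..N}"
  shows "a i \<in> square x y \<longleftrightarrow> i = x \<or> i = y"
  by (simp only: square_def insert_iff empty_iff a_eq_a[OF assms(1,2)] a_eq_a[OF assms(1,3)]
    a_neq(1)[OF assms(1,2)] a_neq(1)[OF assms(1,3)] simp_thms)

lemma circuit_square:
  assumes "x \<in> {1..N}" "y \<in> {1..N}" "x \<noteq> y"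
  shows "circuit (square x y)"
  unfolding circuit_def
proof (intro conjI allI impI)
  show "affine_dependent (square x y)"
    by (rule affine_dependent_square[OF assms])
  fix Y
  assume Y: "Y \<subset> square x y"
  have "square x y \<subseteq> V"
    using assms by (simp add: square_def)
  then have YV: "Y \<subseteq> V"
    using Y by blast
  show "\<not> affine_dependent Y"
  proof
    assume "affine_dependent Y"
    then obtain i j where ij: "i \<in> {1..N}" "j \<in> {1..N}" "i \<noteq> j" "square i j \<subseteq> Y"
      using affine_dependent_iff[OF YV] by blast
    have "a i \<in> square x y" "a j \<in> square x y"
      using ij(4) Y by (auto simp: square_def)
    then have "i = x \<or> i = y" "j = x \<or> j = y"
      using a_in_square assms(1,2) ij(1,2) by blast+
    then have "square i j = square x y"
      using ij(3) square_commute by blast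
    then show False
      using ij(4) Y by blast
  qed
qed

text \<open>The signs come from \<open>a y + b x = a x + b y\<close>. The orientation fits a
  permutation with \<open>x\<close> before \<open>y\<close>: deleting \<open>a y\<close> or
  \<open>b x\<close> leaves triangles that lie in its staircases at the positions of
  \<open>x\<close> and \<open>y\<close>.\<close>

lemma circuit_partition_square:
  assumes "x \<in> {1..N}" "y \<in> {1..N}" "x \<noteq> y"
  shows "circuit_partition (square x y) {a y, b x} {a x, b y}"
proof -
  define u :: "'v \<Rightarrow> real" where "u v = (if v = a y \<or> v = b x then 1 else - 1)" for v
  have u: "u (a y) = 1" "u (b x) = 1" "u (a x) = -1" "u (b y) = -1"
    using assms by (auto simp: u_def)
  have "- a x + b x + a y - b y = (a y + b x) - (a x + b y)"
    by simp
  then have "- a x + b x + a y - b y = 0"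
    using parallel[OF assms(1,2)] by simp
  then have "(\<Sum>v\<in>square x y. u v) = 0" "(\<Sum>v\<in>square x y. u v *\<^sub>R v) = 0"
    using assms by (simp_all add: sum_square u)
  moreover have "{a y, b x} = {v \<in> square x y. u v > 0}" "{a x, b y} = {v \<in> square x y. u v < 0}"
    using u by (auto simp: square_def)
  moreover have "\<exists>z\<in>square x y. u z \<noteq> 0"
    using u by (auto simp: square_def)
  ultimately show ?thesis
    unfolding circuit_partition_def by (intro conjI exI[of _ u] circuit_square[OF assms])
qed

text \<open>Minimality makes the circuit equal to the square it contains, and the column and top
  relations reduce all four weights to the sign of \<open>u (a x)\<close>.\<close>

lemma circuit_partitionE:
  assumes "Z \<subseteq> V" "circuit_partition Z Zp Zm"
  obtains x y where "x \<in> {1..N}" "y \<in> {1..N}" "x \<noteq> y" "Z = square x y" "Zp = {a y, b x}" "Zm = {a x, b y}"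
proof -
  have Z: "affine_dependent Z" "\<And>Y. Y \<subset> Z \<Longrightarrow> \<not> affine_dependent Y"
    using assms(2) by (auto simp: circuit_partition_def circuit_def)
  obtain u z where u: "(\<Sum>z\<in>Z. u z) = 0" "(\<Sum>z\<in>Z. u z *\<^sub>R z) = 0" "z \<in> Z" "u z \<noteq> (0::real)"
    and Zpm: "Zp = {z \<in> Z. u z > 0}" "Zm = {z \<in> Z. u z < 0}"
    using assms(2) by (auto simp: circuit_partition_def)
  obtain x y where xy: "x \<in> {1..N}" "y \<in> {1..N}" "x \<noteq> y" "square x y \<subseteq> Z"
    using Z(1) affine_dependent_iff[OF assms(1)] by blast
  have Zeq: "Z = square x y"
    using Z(2)[of "square x y"] affine_dependent_square[OF xy(1-3)] xy(4) by blast
  obtain w where w: "\<And>v. v \<in> Z \<Longrightarrow> w v = u v" "\<And>v. v \<notin> Z \<Longrightarrow> w v = 0"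
    "(\<Sum>i=1..N. w (a i)) = 0" "\<And>i. i \<in> {1..N} \<Longrightarrow> w (b i) = - w (a i)"
    by (rule dependenceE[OF assms(1) u(1,2)]) (rule that; simp)
  have mem: "a x \<in> Z" "a y \<in> Z" "b x \<in> Z" "b y \<in> Z"
    by (auto simp: Zeq square_def)
  have ub: "u (b x) = - u (a x)" "u (b y) = - u (a y)"
    using w(1)[OF mem(1)] w(1)[OF mem(2)] w(1)[OF mem(3)] w(1)[OF mem(4)] w(4)[OF xy(1)] w(4)[OF xy(2)] by simp_all
  have "(\<Sum>i=1..N. w (a i)) = (\<Sum>i\<in>{x, y}. w (a i))"
  proof (rule sum.mono_neutral_right)
    show "\<forall>i\<in>{1..N} - {x, y}. w (a i) = 0"
      using w(2) a_in_square[OF _ xy(1,2)] unfolding Zeq by blast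
  qed (use xy in auto)
  then have uy: "u (a y) = - u (a x)"
    using w(3) xy(3) w(1)[OF mem(1)] w(1)[OF mem(2)] by simp
  have ux: "u (a x) \<noteq> 0"
    using u(3,4) ub uy by (auto simp: Zeq square_def)
  show thesis
  proof (cases "u (a x) < 0")
    case True
    then have "u (a x) < 0" "u (b y) < 0" "0 < u (b x)" "0 < u (a y)" "\<not> 0 < u (a x)" "\<not> 0 < u (b y)"
      "\<not> u (b x) < 0" "\<not> u (a y) < 0"
      using ub uy by simp_all
    then have "Zp = {a y, b x}" "Zm = {a x, b y}"
      unfolding Zpm Zeq square_def by blast+
    then show thesis
      using that[OF xy(1,2,3) Zeq] by blast
  next
    \<comment> \<open>The opposite sign is the same partition with \<open>x\<close> and
      \<open>y\<close> exchanged.\<close>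
    case False
    then have "0 < u (a x)" "0 < u (b y)" "u (b x) < 0" "u (a y) < 0" "\<not> u (a x) < 0" "\<not> u (b y) < 0"
      "\<not> 0 < u (b x)" "\<not> 0 < u (a y)"
      using ub uy ux by simp_all
    then have "Zp = {a x, b y}" "Zm = {a y, b x}"
      unfolding Zpm Zeq square_def by blast+
    then show thesis
      using that[OF xy(2,1) xy(3)[symmetric]] Zeq square_commute by metis
  qed
qed

text \<open>A maximal simplex of one triangulation lies in one of the other. Both have
  \<open>N + 3\<close> vertices (the apexes and \<open>N + 1\<close> further ones), so they are
  equal.\<close>

lemma complex_of_tri_inject:
  assumes \<pi>: "\<pi> permutes {1..N}" and \<rho>: "\<rho> permutes {1..N}" and eq: "complex_of (tri \<pi>) = complex_of (tri \<rho>)"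
  shows "tri \<pi> = tri \<rho>"
proof -
  have card: "card \<sigma> = N + 3" if T: "T \<in> polytope_triangulations (convex hull V)" and \<sigma>: "\<sigma> \<in> T" for T \<sigma>
  proof -
    note AB = triangulation_A_of_B_of[OF T \<sigma>]
    have sub: "A_of \<sigma> \<subseteq> {1..N}" "B_of \<sigma> \<subseteq> {1..N}"
      using AB(1) by blast+
    have inj: "inj_on a (A_of \<sigma>)" "inj_on b (B_of \<sigma>)"
      using inj_on_subset[OF inj_ab(1) sub(1)] inj_on_subset[OF inj_ab(2) sub(2)] .
    have disj: "a ` A_of \<sigma> \<inter> b ` B_of \<sigma> = {}" "{0, q} \<inter> (a ` A_of \<sigma> \<union> b ` B_of \<sigma>) = {}"
    proof -
      have "a ` {1..N} \<inter> b ` {1..N} = {}" "{0, q} \<inter> (a ` {1..N} \<union> b ` {1..N}) = {}"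
        by auto
      moreover have "a ` A_of \<sigma> \<inter> b ` B_of \<sigma> \<subseteq> a ` {1..N} \<inter> b ` {1..N}"
        "{0, q} \<inter> (a ` A_of \<sigma> \<union> b ` B_of \<sigma>) \<subseteq> {0, q} \<inter> (a ` {1..N} \<union> b ` {1..N})"
        by (intro Int_mono Un_mono image_mono sub subset_refl)+
      ultimately show "a ` A_of \<sigma> \<inter> b ` B_of \<sigma> = {}" "{0, q} \<inter> (a ` A_of \<sigma> \<union> b ` B_of \<sigma>) = {}"
        by (simp_all only: subset_empty)
    qed
    have "card ({0, q} \<union> (a ` A_of \<sigma> \<union> b ` B_of \<sigma>)) = 2 + (card (A_of \<sigma>) + card (B_of \<sigma>))"
      using disj inj by (simp add: card_Un_disjoint card_image)
    then show ?thesis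
      using AB(3) card_A_of(2)[OF T \<sigma>] by (simp add: Un_assoc)
  qed
  have "T \<subseteq> T'" if T: "T \<in> polytope_triangulations (convex hull V)" "T' \<in> polytope_triangulations (convex hull V)"
    and sub: "complex_of T \<subseteq> complex_of T'" for T T'
  proof
    fix \<sigma>
    assume \<sigma>: "\<sigma> \<in> T"
    then have "\<sigma> \<in> complex_of T"
      by (auto simp: complex_of_def)
    then obtain \<tau> where \<tau>: "\<tau> \<in> T'" "\<sigma> \<subseteq> \<tau>"
      using sub by (auto simp: complex_of_def)
    have "finite \<tau>"
      using triangulation_simplex(1)[OF T(2) \<tau>(1)] by (rule finite_subset_V)
    then have "\<sigma> = \<tau>"
      using \<tau>(2) card[OF T(1) \<sigma>] card[OF T(2) \<tau>(1)] by (intro card_subset_eq) simp_all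
    then show "\<sigma> \<in> T'"
      using \<tau> by simp
  qed
  then show ?thesis
    using tri_triangulation[OF \<pi>] tri_triangulation[OF \<rho>] eq by (intro subset_antisym) auto
qed

text \<open>Column \<open>\<pi> k\<close> is full in the staircase at \<open>k\<close> only, so a
  face with both of its ends lies in a single maximal simplex, and its link is the simplex on the
  remaining vertices.\<close>

lemma complex_link_tri:
  assumes \<pi>: "\<pi> permutes {1..N}" and k: "k \<in> {1..N}"
    and \<tau>: "a (\<pi> k) \<in> \<tau>" "b (\<pi> k) \<in> \<tau>" "\<tau> \<subseteq> staircase \<pi> k"
  shows "complex_link (complex_of (tri \<pi>)) \<tau> = Pow (staircase \<pi> k - \<tau>)"
proof -
  have "l = k" if l: "l \<in> {1..N}" "\<tau> \<subseteq> staircase \<pi> l" for l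
    using \<tau> l a_in_staircase[OF \<pi> k l(1)] b_in_staircase[OF \<pi> k l(1)] by (metis le_antisym subsetD)
  then have unique: "\<rho> \<union> \<tau> \<in> complex_of (tri \<pi>) \<longleftrightarrow> \<rho> \<union> \<tau> \<subseteq> staircase \<pi> k" for \<rho>
    using k unfolding complex_of_def tri_def by blast
  have "\<rho> \<in> complex_of (tri \<pi>)" if "\<rho> \<subseteq> staircase \<pi> k" for \<rho>
    using that k by (auto simp: complex_of_def tri_def)
  then show ?thesis
    unfolding complex_link_def unique using \<tau>(3) by blast
qed

text \<open>Among the intervals \<open>{1..k}\<close> and \<open>{k..N}\<close>, only
  \<open>{1..i}\<close> and \<open>{Suc i..N}\<close> separate \<open>i\<close> from
  \<open>Suc i\<close>; all others are preserved by the transposition.\<close>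

lemma staircase_swap_other:
  assumes k: "k \<in> {1..N}" and i: "i \<in> {1..N}" "Suc i \<in> {1..N}" and "k \<noteq> i" "k \<noteq> Suc i"
  shows "staircase (\<pi> \<circ> Transposition.transpose i (Suc i)) k = staircase \<pi> k"
proof -
  have "i \<in> {1..k} \<longleftrightarrow> Suc i \<in> {1..k}" "i \<in> {k..N} \<longleftrightarrow> Suc i \<in> {k..N}"
    using assms unfolding atLeastAtMost_iff by arith+
  then have "Transposition.transpose i (Suc i) ` {1..k} = {1..k}" "Transposition.transpose i (Suc i) ` {k..N} = {k..N}"
    by (simp_all only: transpose_image_eq)
  then show ?thesis
    unfolding staircase_def image_comp[symmetric] by metis
qed

section \<open>The flip at two adjacent positions\<close>

context
  fixes \<pi> i assumes \<pi>: "\<pi> permutes {1..N}" and i: "i \<in> {1..N}" and Si: "Suc i \<in> {1..N}"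
begin

text \<open>What the staircases at positions \<open>i\<close> and \<open>i + 1\<close>, before and
  after the exchange, have outside the square. It spans the link of the flip.\<close>

definition common :: "'v set" where
  "common = {0, q} \<union> a ` \<pi> ` {1..<i} \<union> b ` \<pi> ` {i + 2..N}"

lemma swap_permutes: "\<pi> \<circ> Transposition.transpose i (Suc i) permutes {1..N}"
  by (intro permutes_compose permutes_swap_id \<pi> i Si)

lemma staircase_common:
  shows "staircase \<pi> i = common \<union> {a (\<pi> i), b (\<pi> i), b (\<pi> (Suc i))}"
    and "staircase \<pi> (Suc i) = common \<union> {a (\<pi> i), a (\<pi> (Suc i)), b (\<pi> (Suc i))}"
    and "staircase (\<pi> \<circ> Transposition.transpose i (Suc i)) i = common \<union> {a (\<pi> (Suc i)), b (\<pi> i), b (\<pi> (Suc i))}"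
    and "staircase (\<pi> \<circ> Transposition.transpose i (Suc i)) (Suc i) = common \<union> {a (\<pi> i), a (\<pi> (Suc i)), b (\<pi> i)}"
proof -
  have eqs: "{1..i} = insert i {1..<i}" "{1..Suc i} = insert (Suc i) (insert i {1..<i})"
    "{i..N} = insert i (insert (Suc i) {i + 2..N})" "{Suc i..N} = insert (Suc i) {i + 2..N}"
    using i Si by auto
  have others: "Transposition.transpose i (Suc i) ` {1..<i} = {1..<i}" "Transposition.transpose i (Suc i) ` {i + 2..N} = {i + 2..N}"
    by (simp_all add: transpose_image_eq)
  have "\<pi> ` Transposition.transpose i (Suc i) ` {1..<i} = \<pi> ` {1..<i}" "\<pi> ` Transposition.transpose i (Suc i) ` {i + 2..N} = \<pi> ` {i + 2..N}"
    unfolding others by simp_all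
  then show "staircase \<pi> i = common \<union> {a (\<pi> i), b (\<pi> i), b (\<pi> (Suc i))}"
    "staircase \<pi> (Suc i) = common \<union> {a (\<pi> i), a (\<pi> (Suc i)), b (\<pi> (Suc i))}"
    "staircase (\<pi> \<circ> Transposition.transpose i (Suc i)) i = common \<union> {a (\<pi> (Suc i)), b (\<pi> i), b (\<pi> (Suc i))}"
    "staircase (\<pi> \<circ> Transposition.transpose i (Suc i)) (Suc i) = common \<union> {a (\<pi> i), a (\<pi> (Suc i)), b (\<pi> i)}"
    unfolding staircase_def common_def eqs image_comp[symmetric] image_insert by auto
qed

text \<open>All four staircases contain \<open>common\<close>, and each vertex of the square is
  missing from one of them.\<close>

lemma common_disjoint:
  "a (\<pi> i) \<notin> common" "b (\<pi> i) \<notin> common" "a (\<pi> (Suc i)) \<notin> common" "b (\<pi> (Suc i)) \<notin> common"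
proof -
  have "common \<subseteq> staircase \<pi> i" "common \<subseteq> staircase \<pi> (Suc i)"
    unfolding staircase_common by auto
  then show "a (\<pi> (Suc i)) \<notin> common" "b (\<pi> i) \<notin> common"
    using a_in_staircase[OF \<pi> Si i] b_in_staircase[OF \<pi> i Si] by auto
  note \<rho> = swap_permutes
  have "common \<subseteq> staircase (\<pi> \<circ> Transposition.transpose i (Suc i)) i" "common \<subseteq> staircase (\<pi> \<circ> Transposition.transpose i (Suc i)) (Suc i)"
    unfolding staircase_common by auto
  then show "a (\<pi> i) \<notin> common" "b (\<pi> (Suc i)) \<notin> common"
    using a_in_staircase[OF \<rho> Si i] b_in_staircase[OF \<rho> i Si] by auto
qed

lemma perm_neq: "\<pi> i \<noteq> \<pi> (Suc i)"
  by (simp add: perm_eq[OF \<pi>])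

lemma links:
  "complex_link (complex_of (tri \<pi>)) {a (\<pi> i), b (\<pi> i), b (\<pi> (Suc i))} = Pow common"
  "complex_link (complex_of (tri \<pi>)) {a (\<pi> i), a (\<pi> (Suc i)), b (\<pi> (Suc i))} = Pow common"
proof -
  have "staircase \<pi> i - {a (\<pi> i), b (\<pi> i), b (\<pi> (Suc i))} = common"
    "staircase \<pi> (Suc i) - {a (\<pi> i), a (\<pi> (Suc i)), b (\<pi> (Suc i))} = common"
    unfolding staircase_common using common_disjoint by blast+
  moreover have "complex_link (complex_of (tri \<pi>)) {a (\<pi> i), b (\<pi> i), b (\<pi> (Suc i))} =
      Pow (staircase \<pi> i - {a (\<pi> i), b (\<pi> i), b (\<pi> (Suc i))})"
    by (rule complex_link_tri[OF \<pi> i]) (unfold staircase_common, blast+)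
  moreover have "complex_link (complex_of (tri \<pi>)) {a (\<pi> i), a (\<pi> (Suc i)), b (\<pi> (Suc i))} =
      Pow (staircase \<pi> (Suc i) - {a (\<pi> i), a (\<pi> (Suc i)), b (\<pi> (Suc i))})"
    by (rule complex_link_tri[OF \<pi> Si]) (unfold staircase_common, blast+)
  ultimately show "complex_link (complex_of (tri \<pi>)) {a (\<pi> i), b (\<pi> i), b (\<pi> (Suc i))} = Pow common"
    "complex_link (complex_of (tri \<pi>)) {a (\<pi> i), a (\<pi> (Suc i)), b (\<pi> (Suc i))} = Pow common"
    by (simp_all only:)
qed

lemma complex_of_swap:
  "complex_of (tri (\<pi> \<circ> Transposition.transpose i (Suc i))) =
    (complex_of (tri \<pi>) - complex_join (complex_of (circuit_triangulation (square (\<pi> i) (\<pi> (Suc i)))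
      {a (\<pi> (Suc i)), b (\<pi> i)})) (Pow common))
    \<union> complex_join (complex_of (circuit_triangulation (square (\<pi> i) (\<pi> (Suc i)))
      {a (\<pi> i), b (\<pi> (Suc i))})) (Pow common)" (is "complex_of (tri ?\<rho>) = _")
proof -
  let ?R = "staircase \<pi> ` ({1..N} - {i, Suc i})"
  note xy = perm_in[OF \<pi> i] perm_in[OF \<pi> Si] perm_neq
  have I: "{1..N} = ({1..N} - {i, Suc i}) \<union> {i, Suc i}"
    using i Si by blast
  have "tri \<pi> = ?R \<union> {staircase \<pi> i, staircase \<pi> (Suc i)}"
    unfolding tri_def by (subst I) auto
  then have \<pi>R: "complex_of (tri \<pi>) = complex_of ?R \<union> complex_of {staircase \<pi> i, staircase \<pi> (Suc i)}"
    by (simp only: complex_of_Un)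
  have "staircase ?\<rho> ` ({1..N} - {i, Suc i}) = ?R"
    using staircase_swap_other[OF _ i Si] by (intro image_cong) auto
  then have "tri ?\<rho> = ?R \<union> {staircase ?\<rho> i, staircase ?\<rho> (Suc i)}"
    unfolding tri_def by (subst I) auto
  then have \<rho>R: "complex_of (tri ?\<rho>) = complex_of ?R \<union> complex_of {staircase ?\<rho> i, staircase ?\<rho> (Suc i)}"
    by (simp only: complex_of_Un)
  \<comment> \<open>Removing the old join also deletes faces shared with untouched simplices, and
    the new join must restore them. Such a face misses \<open>a (\<pi> i)\<close> if the untouched
    simplex has a smaller position, and \<open>b (\<pi> (Suc i))\<close> if it has a larger one, so
    it fits into a new staircase.\<close>
  have "\<phi> \<in> complex_of {staircase ?\<rho> i, staircase ?\<rho> (Suc i)}"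
    if \<phi>R: "\<phi> \<in> complex_of ?R" and \<phi>i: "\<phi> \<in> complex_of {staircase \<pi> i, staircase \<pi> (Suc i)}" for \<phi>
  proof -
    obtain k where k: "k \<in> {1..N}" "k \<noteq> i" "k \<noteq> Suc i" "\<phi> \<subseteq> staircase \<pi> k"
      using \<phi>R unfolding complex_of_def by blast
    have \<phi>: "\<phi> \<subseteq> common \<union> {a (\<pi> i), a (\<pi> (Suc i)), b (\<pi> i), b (\<pi> (Suc i))}"
      using \<phi>i unfolding complex_of_def staircase_common by auto
    show ?thesis
    proof (cases "k < i")
      case True
      then have "a (\<pi> i) \<notin> \<phi>"
        using k a_in_staircase[OF \<pi> i k(1)] by auto
      then have "\<phi> \<subseteq> staircase ?\<rho> i"
        unfolding staircase_common using \<phi> \<open>a (\<pi> i) \<notin> \<phi>\<close> k True a_in_staircase[OF \<pi> Si k(1)] by auto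
      then show ?thesis
        by (auto simp: complex_of_def)
    next
      case False
      then have "b (\<pi> (Suc i)) \<notin> \<phi>"
        using k b_in_staircase[OF \<pi> Si k(1)] by auto
      then have "\<phi> \<subseteq> staircase ?\<rho> (Suc i)"
        unfolding staircase_common using \<phi> k by auto
      then show ?thesis
        by (auto simp: complex_of_def)
    qed
  qed
  then have "complex_of (tri ?\<rho>) =
      (complex_of (tri \<pi>) - complex_of {staircase \<pi> i, staircase \<pi> (Suc i)}) \<union> complex_of {staircase ?\<rho> i, staircase ?\<rho> (Suc i)}"
    unfolding \<pi>R \<rho>R by blast
  then show ?thesis
    unfolding complex_join_Pow circuit_triangulation_doubleton square_Diff[OF xy] staircase_common image_insert image_empty .
qed

lemma differ_by_flip_swap: "differ_by_flip V (tri \<pi>) (tri (\<pi> \<circ> Transposition.transpose i (Suc i)))"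
proof -
  let ?Z = "square (\<pi> i) (\<pi> (Suc i))"
  note xy = perm_in[OF \<pi> i] perm_in[OF \<pi> Si] perm_neq
  have ct: "circuit_triangulation ?Z {a (\<pi> (Suc i)), b (\<pi> i)} =
      {{a (\<pi> i), b (\<pi> i), b (\<pi> (Suc i))}, {a (\<pi> i), a (\<pi> (Suc i)), b (\<pi> (Suc i))}}"
    unfolding circuit_triangulation_doubleton square_Diff[OF xy] ..
  have "?Z \<subseteq> V"
    using xy by (simp add: square_def)
  moreover have "complex_of (circuit_triangulation ?Z {a (\<pi> (Suc i)), b (\<pi> i)}) \<subseteq> complex_of (tri \<pi>)"
  proof -
    have mem: "staircase \<pi> i \<in> tri \<pi>" "staircase \<pi> (Suc i) \<in> tri \<pi>"
      using i Si by (auto simp: tri_def)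
    have sub: "{a (\<pi> i), b (\<pi> i), b (\<pi> (Suc i))} \<subseteq> staircase \<pi> i"
      "{a (\<pi> i), a (\<pi> (Suc i)), b (\<pi> (Suc i))} \<subseteq> staircase \<pi> (Suc i)"
      unfolding staircase_common by blast+
    have "\<exists>\<tau>\<in>tri \<pi>. {a (\<pi> i), b (\<pi> i), b (\<pi> (Suc i))} \<subseteq> \<tau>"
      using sub(1) mem(1) by (rule bexI[of _ "staircase \<pi> i"])
    moreover have "\<exists>\<tau>\<in>tri \<pi>. {a (\<pi> i), a (\<pi> (Suc i)), b (\<pi> (Suc i))} \<subseteq> \<tau>"
      using sub(2) mem(2) by (rule bexI[of _ "staircase \<pi> (Suc i)"])
    ultimately show ?thesis
      unfolding ct by (intro complex_of_mono) (elim insertE emptyE; simp only:)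
  qed
  moreover have "\<forall>\<sigma>\<in>circuit_triangulation ?Z {a (\<pi> (Suc i)), b (\<pi> i)}. complex_link (complex_of (tri \<pi>)) \<sigma> = Pow common"
    unfolding ct using links by simp
  ultimately show ?thesis
    unfolding differ_by_flip_def using circuit_partition_square[OF xy] complex_of_swap by blast
qed

end

text \<open>
  If \<open>\<pi> i\<close> and \<open>\<pi> j\<close> span the circuit of a flip but \<open>i + 1 < j\<close>, the vertex \<open>b (\<pi> (i + 1))\<close>
  lies in the link of one of the two simplices of the circuit and not in that of the other.
\<close>

lemma differ_by_flip_triD:
  assumes \<pi>: "\<pi> permutes {1..N}" and \<rho>: "\<rho> permutes {1..N}" and flip: "differ_by_flip V (tri \<pi>) (tri \<rho>)"
  shows "\<exists>i. i \<in> {1..N} \<and> Suc i \<in> {1..N} \<and> \<rho> = \<pi> \<circ> Transposition.transpose i (Suc i)"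
proof -
  obtain Z Zp Zm M where Z: "Z \<subseteq> V" "circuit_partition Z Zp Zm"
    and sub: "complex_of (circuit_triangulation Z Zp) \<subseteq> complex_of (tri \<pi>)"
    and link: "\<forall>\<sigma>\<in>circuit_triangulation Z Zp. complex_link (complex_of (tri \<pi>)) \<sigma> = M"
    and eq: "complex_of (tri \<rho>) = (complex_of (tri \<pi>) - complex_join (complex_of (circuit_triangulation Z Zp)) M)
       \<union> complex_join (complex_of (circuit_triangulation Z Zm)) M"
    using flip unfolding differ_by_flip_def by blast
  obtain x y where xy: "x \<in> {1..N}" "y \<in> {1..N}" "x \<noteq> y"
    and Zxy: "Z = square x y" "Zp = {a y, b x}" "Zm = {a x, b y}"
    by (rule circuit_partitionE[OF Z])
  obtain i where i: "i \<in> {1..N}" "x = \<pi> i"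
    using xy(1) by (rule perm_cases[OF \<pi>])
  obtain j where j: "j \<in> {1..N}" "y = \<pi> j"
    using xy(2) by (rule perm_cases[OF \<pi>])
  have ct: "circuit_triangulation Z Zp = {{a x, b x, b y}, {a x, a y, b y}}"
    unfolding Zxy circuit_triangulation_doubleton square_Diff[OF xy] ..
  have "{a x, b x, b y} \<in> complex_of (circuit_triangulation Z Zp)"
    unfolding ct complex_of_def by blast
  then have "{a x, b x, b y} \<in> complex_of (tri \<pi>)"
    using sub by blast
  then obtain k where k: "k \<in> {1..N}" "{a x, b x, b y} \<subseteq> staircase \<pi> k"
    unfolding complex_of_def tri_def by blast
  \<comment> \<open>The full column \<open>x\<close> fixes the position as \<open>i\<close>, and the
    bottom vertex \<open>b y\<close> puts \<open>y\<close> after \<open>x\<close>.\<close>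
  then have "i \<le> k" "k \<le> i" "k \<le> j"
    using i j a_in_staircase[OF \<pi> i(1) k(1)] b_in_staircase[OF \<pi> i(1) k(1)] b_in_staircase[OF \<pi> j(1) k(1)] by auto
  then have "i < j"
    using i j xy(3) by (cases "i = j") auto
  have linki: "complex_link (complex_of (tri \<pi>)) {a x, b x, b y} = Pow (staircase \<pi> i - {a x, b x, b y})"
    using i j \<open>i < j\<close> by (intro complex_link_tri[OF \<pi> i(1)]) (auto simp: a_in_staircase[OF \<pi>] b_in_staircase[OF \<pi>])
  have linkj: "complex_link (complex_of (tri \<pi>)) {a x, a y, b y} = Pow (staircase \<pi> j - {a x, a y, b y})"
    using i j \<open>i < j\<close> by (intro complex_link_tri[OF \<pi> j(1)]) (auto simp: a_in_staircase[OF \<pi>] b_in_staircase[OF \<pi>])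
  have "M = Pow (staircase \<pi> i - {a x, b x, b y})" "M = Pow (staircase \<pi> j - {a x, a y, b y})"
    using link linki linkj by (simp_all add: ct)
  then have same: "staircase \<pi> i - {a x, b x, b y} = staircase \<pi> j - {a x, a y, b y}"
    by (metis Pow_top PowD subset_antisym)
  have Si: "Suc i \<in> {1..N}"
    using \<open>i < j\<close> j by simp
  have "j = Suc i"
  proof (rule ccontr)
    assume "j \<noteq> Suc i"
    then have "Suc i < j"
      using \<open>i < j\<close> by simp
    have in\<pi>: "\<pi> (Suc i) \<in> {1..N}" "\<pi> (Suc i) \<noteq> x" "\<pi> (Suc i) \<noteq> y"
      using perm_in[OF \<pi> Si] perm_eq[OF \<pi>] i j \<open>j \<noteq> Suc i\<close> by auto
    have "b (\<pi> (Suc i)) \<notin> {a x, b x, b y}"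
      using in\<pi>(2,3)
      by (simp only: insert_iff empty_iff b_eq_b[OF in\<pi>(1) xy(1)] b_eq_b[OF in\<pi>(1) xy(2)]
        a_neq(2)[OF xy(1) in\<pi>(1)] simp_thms)
    moreover have "b (\<pi> (Suc i)) \<in> staircase \<pi> i" "b (\<pi> (Suc i)) \<notin> staircase \<pi> j"
      using b_in_staircase[OF \<pi> Si i(1)] b_in_staircase[OF \<pi> Si j(1)] \<open>Suc i < j\<close> by simp_all
    ultimately show False
      using same by blast
  qed
  \<comment> \<open>Circuit, orientation and link are now those of the exchange at \<open>i\<close>,
    so the flip formula yields the complex of the exchanged permutation.\<close>
  have "M = Pow (common \<pi> i)"
    using link links(1)[OF \<pi> i(1) Si] i j \<open>j = Suc i\<close> by (simp add: ct)
  then have "complex_of (tri \<rho>) = complex_of (tri (\<pi> \<circ> Transposition.transpose i (Suc i)))"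
    using eq complex_of_swap[OF \<pi> i(1) Si] i j \<open>j = Suc i\<close> by (simp add: Zxy)
  then have "tri \<rho> = tri (\<pi> \<circ> Transposition.transpose i (Suc i))"
    using complex_of_tri_inject \<rho> swap_permutes[OF \<pi> i(1) Si] by blast
  then have "\<rho> = \<pi> \<circ> Transposition.transpose i (Suc i)"
    using inj_on_tri \<rho> swap_permutes[OF \<pi> i(1) Si] by (auto dest: inj_onD)
  then show ?thesis
    using i(1) Si by blast
qed

text \<open>An edge forgets the direction of the flip. Nothing is lost, since a transposition is an
  involution and the relation on permutations is symmetric.\<close>

lemma flip_graph_edge_iff:
  assumes \<pi>: "\<pi> permutes {1..N}" and \<rho>: "\<rho> permutes {1..N}"
  shows "{tri \<pi>, tri \<rho>} \<in> snd (flip_graph (convex hull V)) \<longleftrightarrow>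
    (\<exists>i. i \<in> {1..N} \<and> Suc i \<in> {1..N} \<and> \<rho> = \<pi> \<circ> Transposition.transpose i (Suc i))" (is "_ \<longleftrightarrow> ?R \<pi> \<rho>")
proof -
  have sym: "?R \<rho> \<pi> \<longleftrightarrow> ?R \<pi> \<rho>" for \<pi> \<rho> :: "nat \<Rightarrow> nat"
    by (metis comp_assoc comp_id transpose_comp_involutory)
  have neq: "\<pi> \<noteq> \<rho>" if "?R \<pi> \<rho>"
  proof
    assume "\<pi> = \<rho>"
    with that obtain i where "\<pi> = \<pi> \<circ> Transposition.transpose i (Suc i)"
      by blast
    then have "\<pi> i = \<pi> (Suc i)"
      by (metis comp_apply transpose_apply_first)
    then show False
      by (simp add: perm_eq[OF \<pi>])
  qed
  show ?thesis
  proof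
    assume "{tri \<pi>, tri \<rho>} \<in> snd (flip_graph (convex hull V))"
    then have "differ_by_flip V (tri \<pi>) (tri \<rho>) \<or> differ_by_flip V (tri \<rho>) (tri \<pi>)"
      by (auto simp: flip_graph_def polytope_vertices_prism doubleton_eq_iff)
    then show "?R \<pi> \<rho>"
      using differ_by_flip_triD[OF \<pi> \<rho>] differ_by_flip_triD[OF \<rho> \<pi>] sym by blast
  next
    assume R: "?R \<pi> \<rho>"
    then have "differ_by_flip V (tri \<pi>) (tri \<rho>)"
      using differ_by_flip_swap[OF \<pi>] by blast
    moreover have "tri \<pi> \<noteq> tri \<rho>"
      using inj_on_tri \<pi> \<rho> neq[OF R] by (auto dest: inj_onD)
    ultimately show "{tri \<pi>, tri \<rho>} \<in> snd (flip_graph (convex hull V))"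
      using tri_triangulation[OF \<pi>] tri_triangulation[OF \<rho>]
      by (auto simp: flip_graph_def polytope_vertices_prism)
  qed
qed

end

section \<open>The snake poset of a constant word and its order polytope\<close>

text \<open>The two chains of the snake poset are labelled \<open>0 > 1 > 4 > 6 > \<dots>\<close> and \<open>2 > 3 > 5 > 7 > \<dots>\<close>.\<close>

definition upper :: "nat \<Rightarrow> nat" where "upper j = (if j \<le> 1 then j else 2 * j)"

definition lower :: "nat \<Rightarrow> nat" where "lower j = (if j = 0 then 2 else 2 * j + 1)"

lemma upper_lower_eq [simp]:
  "upper i = upper j \<longleftrightarrow> i = j" "lower i = lower j \<longleftrightarrow> i = j" "upper i \<noteq> lower j" "lower j \<noteq> upper i"
proof -
  show "upper i = upper j \<longleftrightarrow> i = j"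
    unfolding upper_def by (cases "i \<le> 1"; cases "j \<le> 1"; simp; linarith)
  show "lower i = lower j \<longleftrightarrow> i = j"
    unfolding lower_def by (cases "i = 0"; cases "j = 0"; simp)
  show "upper i \<noteq> lower j"
    unfolding upper_def lower_def by (cases "i \<le> 1"; cases "j = 0"; simp; presburger)
  then show "lower j \<noteq> upper i"
    by simp
qed

text \<open>The covers after \<open>k\<close> letters: two rails with \<open>k + 2\<close> elements
  each and a rung at every index. Indices grow downwards in the order.\<close>

definition ladder_covers :: "nat \<Rightarrow> nat rel" where
  "ladder_covers k = (\<lambda>j. (upper (Suc j), upper j)) ` {..k} \<union> (\<lambda>j. (lower (Suc j), lower j)) ` {..k} \<union>
    (\<lambda>j. (lower j, upper j)) ` {..Suc k}"

definition ladder :: "nat \<Rightarrow> nat rel" where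
  "ladder n = {(upper j, upper i) | i j. i \<le> j \<and> j \<le> n} \<union> {(lower j, lower i) | i j. i \<le> j \<and> j \<le> n} \<union>
    {(lower j, upper i) | i j. i \<le> j \<and> j \<le> n}"

section \<open>The order generated by the covers of a constant word\<close>

lemma snake_covers_eq: "k \<le> m \<Longrightarrow> snake_covers (replicate m LetterL) k = ladder_covers k"
proof (induction k)
  case 0
  then show ?case
    by (auto simp: ladder_covers_def upper_def lower_def atMost_Suc)
next
  case (Suc k)
  have "ladder_covers (Suc k) = ladder_covers k \<union>
    {(upper (Suc (Suc k)), upper (Suc k)), (lower (Suc (Suc k)), lower (Suc k)), (lower (Suc (Suc k)), upper (Suc (Suc k)))}"
    unfolding ladder_covers_def atMost_Suc[of "Suc k"] atMost_Suc[of k] by auto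
  moreover have "letter_at (replicate m LetterL) (Suc k) = LetterL"
    "k \<noteq> 0 \<Longrightarrow> letter_at (replicate m LetterL) k = LetterL"
    using Suc.prems by (simp_all add: letter_at_def)
  ultimately show ?case
    \<comment> \<open>The first letter attaches 4 below 1, whereas each later one attaches
      \<open>2 * m + 2\<close> below \<open>2 * m\<close>; this is the irregularity in
      \<open>upper\<close>.\<close>
    using Suc by (cases "k = 0") (auto simp: upper_def lower_def)
qed

lemma range_upper_lower: "x \<le> 2 * n + 1 \<longleftrightarrow> (\<exists>j\<le>n. x = upper j \<or> x = lower j)" if "1 \<le> n"
proof
  assume x: "x \<le> 2 * n + 1"
  show "\<exists>j\<le>n. x = upper j \<or> x = lower j"
  proof (cases "x \<le> 3")
    case True
    then have "x = upper 0 \<or> x = upper 1 \<or> x = lower 0 \<or> x = lower 1"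
      by (auto simp: upper_def lower_def)
    then show ?thesis
      using that by blast
  next
    case False
    show ?thesis
    proof (cases "even x")
      case True
      then have "x = upper (x div 2)"
        using False by (auto simp: upper_def)
      then show ?thesis
        using x by (intro exI[of _ "x div 2"]) auto
    next
      case odd: False
      then have "x = lower (x div 2)"
        using False by (auto simp: lower_def)
      then show ?thesis
        using x by (intro exI[of _ "x div 2"]) auto
    qed
  qed
next
  assume "\<exists>j\<le>n. x = upper j \<or> x = lower j"
  then show "x \<le> 2 * n + 1"
    using that by (auto simp: upper_def lower_def split: if_splits)
qed

lemma ladder_step: "(x, y) \<in> ladder (Suc k) \<Longrightarrow> (y, z) \<in> ladder_covers k \<Longrightarrow> (x, z) \<in> ladder (Suc k)"
  unfolding ladder_def ladder_covers_def by (auto 0 3)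

lemma ladder_subset_rtrancl: "ladder (Suc k) \<subseteq> (ladder_covers k)\<^sup>*"
proof -
  have upper: "(upper j, upper i) \<in> (ladder_covers k)\<^sup>*" if "i \<le> j" "j \<le> Suc k" for i j
    using that
  proof (induction j rule: dec_induct)
    case (step j)
    then have "(upper (Suc j), upper j) \<in> ladder_covers k"
      by (auto simp: ladder_covers_def)
    then show ?case
      using step by (meson Suc_leD converse_rtrancl_into_rtrancl)
  qed simp
  have lower: "(lower j, lower i) \<in> (ladder_covers k)\<^sup>*" if "i \<le> j" "j \<le> Suc k" for i j
    using that
  proof (induction j rule: dec_induct)
    case (step j)
    then have "(lower (Suc j), lower j) \<in> ladder_covers k"
      by (auto simp: ladder_covers_def)
    then show ?case
      using step by (meson Suc_leD converse_rtrancl_into_rtrancl)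
  qed simp
  have "(lower j, upper i) \<in> (ladder_covers k)\<^sup>*" if "i \<le> j" "j \<le> Suc k" for i j
  proof -
    have "(lower j, upper j) \<in> ladder_covers k"
      using that by (auto simp: ladder_covers_def)
    then show ?thesis
      using upper[OF that] by (rule converse_rtrancl_into_rtrancl)
  qed
  then show ?thesis
    using upper lower unfolding ladder_def by blast
qed

text \<open>The reflexive closure contains \<open>(x, x)\<close> for every natural number; the
  restriction to the labels removes the extra pairs. With \<open>n - 1\<close> letters the largest
  label is \<open>2 * n + 1\<close>.\<close>

lemma snake_poset_eq_ladder:
  assumes "1 \<le> n"
  shows "snake_poset (replicate (n - 1) LetterL) = ladder n"
proof -
  obtain k where n: "n = Suc k"
    using assms by (cases n) auto
  have "snake_covers (replicate (n - 1) LetterL) (length (replicate (n - 1) LetterL)) = ladder_covers k"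
    "2 * length (replicate (n - 1) LetterL) + 3 = 2 * n + 1"
    using snake_covers_eq[of k k] n by simp_all
  then have "snake_poset (replicate (n - 1) LetterL) = Restr ((ladder_covers k)\<^sup>*) {0..2 * n + 1}"
    by (simp only: snake_poset_def)
  also have "\<dots> = ladder n"
  proof
    have "(x, y) \<in> ladder n" if "(x, y) \<in> (ladder_covers k)\<^sup>*" "x \<le> 2 * n + 1" for x y
      using that(1)
    proof (induction rule: rtrancl_induct)
      case base
      show ?case
        using that(2) range_upper_lower[OF assms] by (auto simp: ladder_def)
    next
      case (step y z)
      then show ?case
        using ladder_step n by blast
    qed
    then show "Restr ((ladder_covers k)\<^sup>*) {0..2 * n + 1} \<subseteq> ladder n"
      by auto
    have "x \<le> 2 * n + 1 \<and> y \<le> 2 * n + 1" if "(x, y) \<in> ladder n" for x y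
      using that unfolding range_upper_lower[OF assms] ladder_def by (auto intro: le_trans)
    then show "ladder n \<subseteq> Restr ((ladder_covers k)\<^sup>*) {0..2 * n + 1}"
      using ladder_subset_rtrancl[of k] n by fastforce
  qed
  finally show ?thesis .
qed

section \<open>Meet-irreducible elements of the ladder with bounds adjoined\<close>

lemma unique_cover:
  assumes "antisym r" "(x, c) \<in> r" "x \<noteq> c" "\<And>z. \<lbrakk>(x, z) \<in> r; z \<noteq> x\<rbrakk> \<Longrightarrow> (c, z) \<in> r"
  shows "\<exists>!y. covered_by r x y"
proof (rule ex1I[of _ c])
  show "covered_by r x c"
    unfolding covered_by_def using assms by (metis antisymD)
  \<comment> \<open>Otherwise \<open>c\<close> would lie strictly between \<open>x\<close> and
    \<open>y\<close>.\<close>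
  show "y = c" if "covered_by r x y" for y
    using that assms unfolding covered_by_def by metis
qed

context
  fixes n :: nat
begin

definition hat_ladder :: "nat hat rel" where "hat_ladder = hat_poset (ladder n)"

lemma ladder_simps [simp]:
  "(upper j, upper i) \<in> ladder n \<longleftrightarrow> i \<le> j \<and> j \<le> n" "(lower j, lower i) \<in> ladder n \<longleftrightarrow> i \<le> j \<and> j \<le> n"
  "(lower j, upper i) \<in> ladder n \<longleftrightarrow> i \<le> j \<and> j \<le> n" "(upper j, lower i) \<notin> ladder n"
  by (auto simp: ladder_def)

lemma Field_ladder: "Field (ladder n) = upper ` {..n} \<union> lower ` {..n}"
proof
  show "Field (ladder n) \<subseteq> upper ` {..n} \<union> lower ` {..n}"
    by (auto simp: Field_def ladder_def)
  have "(x, x) \<in> ladder n" if "x \<in> upper ` {..n} \<union> lower ` {..n}" for x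
    using that by auto
  then show "upper ` {..n} \<union> lower ` {..n} \<subseteq> Field (ladder n)"
    by (meson FieldI1 subsetI)
qed

lemma hat_ladder_cases:
  assumes "(x, y) \<in> hat_ladder"
  obtains "x = Bot" "y = Bot" | "x = Bot" "y = Top" | "x = Top" "y = Top"
  | j where "j \<le> n" "x = Bot" "y = Elt (upper j)" | j where "j \<le> n" "x = Bot" "y = Elt (lower j)"
  | j where "j \<le> n" "x = Elt (upper j)" "y = Top" | j where "j \<le> n" "x = Elt (lower j)" "y = Top"
  | i j where "i \<le> j" "j \<le> n" "x = Elt (upper j)" "y = Elt (upper i)"
  | i j where "i \<le> j" "j \<le> n" "x = Elt (lower j)" "y = Elt (lower i)"
  | i j where "i \<le> j" "j \<le> n" "x = Elt (lower j)" "y = Elt (upper i)"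
  using assms unfolding hat_ladder_def hat_poset_def Field_ladder by (auto simp: ladder_def)

lemma hat_ladder_simps [simp]:
  "(Bot, Bot) \<in> hat_ladder" "(Bot, Top) \<in> hat_ladder" "(Top, Top) \<in> hat_ladder"
  "(x, Bot) \<in> hat_ladder \<longleftrightarrow> x = Bot" "(Top, y) \<in> hat_ladder \<longleftrightarrow> y = Top"
  "(Bot, Elt (upper j)) \<in> hat_ladder \<longleftrightarrow> j \<le> n" "(Bot, Elt (lower j)) \<in> hat_ladder \<longleftrightarrow> j \<le> n"
  "(Elt (upper j), Top) \<in> hat_ladder \<longleftrightarrow> j \<le> n" "(Elt (lower j), Top) \<in> hat_ladder \<longleftrightarrow> j \<le> n"
  "(Elt (upper j), Elt (upper i)) \<in> hat_ladder \<longleftrightarrow> i \<le> j \<and> j \<le> n"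
  "(Elt (lower j), Elt (lower i)) \<in> hat_ladder \<longleftrightarrow> i \<le> j \<and> j \<le> n"
  "(Elt (lower j), Elt (upper i)) \<in> hat_ladder \<longleftrightarrow> i \<le> j \<and> j \<le> n"
  "(Elt (upper j), Elt (lower i)) \<notin> hat_ladder"
  unfolding hat_ladder_def hat_poset_def Field_ladder by auto

lemma antisym_hat_ladder: "antisym hat_ladder"
proof (rule antisymI)
  show "x = y" if "(x, y) \<in> hat_ladder" "(y, x) \<in> hat_ladder" for x y
    using that(1) by (cases rule: hat_ladder_cases) (use that(2) in auto)
qed

lemma Field_hat_ladder: "Field hat_ladder = {Bot, Top} \<union> Elt ` upper ` {..n} \<union> Elt ` lower ` {..n}"
proof
  show "Field hat_ladder \<subseteq> {Bot, Top} \<union> Elt ` upper ` {..n} \<union> Elt ` lower ` {..n}"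
  proof
    fix x
    assume "x \<in> Field hat_ladder"
    then consider y where "(x, y) \<in> hat_ladder" | y where "(y, x) \<in> hat_ladder"
      by (auto simp: Field_def)
    then show "x \<in> {Bot, Top} \<union> Elt ` upper ` {..n} \<union> Elt ` lower ` {..n}"
    proof cases
      case 1
      then show ?thesis
        by (cases rule: hat_ladder_cases) auto
    next
      case 2
      then show ?thesis
        by (cases rule: hat_ladder_cases) auto
    qed
  qed
  have "(x, x) \<in> hat_ladder" if "x \<in> {Bot, Top} \<union> Elt ` upper ` {..n} \<union> Elt ` lower ` {..n}" for x
    using that by auto
  then show "{Bot, Top} \<union> Elt ` upper ` {..n} \<union> Elt ` lower ` {..n} \<subseteq> Field hat_ladder"
    by (meson FieldI1 subsetI)
qed

text \<open>The only cover of \<open>upper (Suc i)\<close> is \<open>upper i\<close>, that of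
  \<open>upper 0\<close> is \<open>Top\<close>, that of \<open>lower 0\<close> (the label 2) is
  \<open>upper 0\<close>, and that of \<open>Bot\<close> is \<open>lower n\<close>. Each
  \<open>lower (Suc i)\<close> has two covers, \<open>lower i\<close> and
  \<open>upper (Suc i)\<close>.\<close>

lemma meet_irreducibles_hat_ladder: "meet_irreducibles hat_ladder = {Bot, Elt 2} \<union> Elt ` upper ` {..n}"
proof -
  have Elt_2_eq: "Elt 2 = Elt (lower 0)"
    by (simp add: lower_def)
  have up0: "\<exists>!y. covered_by hat_ladder (Elt (upper 0)) y"
  proof (rule unique_cover[OF antisym_hat_ladder, of _ Top])
    show "(Top, z) \<in> hat_ladder" if "(Elt (upper 0), z) \<in> hat_ladder" "z \<noteq> Elt (upper 0)" for z
      using that(1) by (cases rule: hat_ladder_cases) (use that(2) in auto)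
  qed simp_all
  have up: "\<exists>!y. covered_by hat_ladder (Elt (upper (Suc i))) y" if "Suc i \<le> n" for i
  proof (rule unique_cover[OF antisym_hat_ladder, of _ "Elt (upper i)"])
    show "(Elt (upper i), z) \<in> hat_ladder" if z: "(Elt (upper (Suc i)), z) \<in> hat_ladder" "z \<noteq> Elt (upper (Suc i))" for z
      using z(1) by (cases rule: hat_ladder_cases) (use z(2) in auto)
  qed (use that in simp_all)
  have low0: "\<exists>!y. covered_by hat_ladder (Elt (lower 0)) y"
  proof (rule unique_cover[OF antisym_hat_ladder, of _ "Elt (upper 0)"])
    show "(Elt (upper 0), z) \<in> hat_ladder" if "(Elt (lower 0), z) \<in> hat_ladder" "z \<noteq> Elt (lower 0)" for z
      using that(1) by (cases rule: hat_ladder_cases) (use that(2) in auto)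
  qed simp_all
  have bot: "\<exists>!y. covered_by hat_ladder Bot y"
  proof (rule unique_cover[OF antisym_hat_ladder, of _ "Elt (lower n)"])
    show "(Elt (lower n), z) \<in> hat_ladder" if "(Bot, z) \<in> hat_ladder" "z \<noteq> Bot" for z
      using that(1) by (cases rule: hat_ladder_cases) (use that(2) in auto)
  qed simp_all
  have low: "\<not> (\<exists>!y. covered_by hat_ladder (Elt (lower (Suc i))) y)" if i: "Suc i \<le> n" for i
  proof -
    have "covered_by hat_ladder (Elt (lower (Suc i))) (Elt (lower i))"
      unfolding covered_by_def
    proof (intro conjI notI)
      assume "\<exists>z. z \<noteq> Elt (lower (Suc i)) \<and> z \<noteq> Elt (lower i) \<and> (Elt (lower (Suc i)), z) \<in> hat_ladder \<and>
        (z, Elt (lower i)) \<in> hat_ladder"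
      then obtain z where z: "z \<noteq> Elt (lower (Suc i))" "z \<noteq> Elt (lower i)" "(z, Elt (lower i)) \<in> hat_ladder"
        "(Elt (lower (Suc i)), z) \<in> hat_ladder"
        by blast
      from z(4) show False
        by (cases rule: hat_ladder_cases) (use z in \<open>auto simp: le_Suc_eq\<close>)
    qed (use i in simp_all)
    moreover have "covered_by hat_ladder (Elt (lower (Suc i))) (Elt (upper (Suc i)))"
      unfolding covered_by_def
    proof (intro conjI notI)
      assume "\<exists>z. z \<noteq> Elt (lower (Suc i)) \<and> z \<noteq> Elt (upper (Suc i)) \<and> (Elt (lower (Suc i)), z) \<in> hat_ladder \<and>
        (z, Elt (upper (Suc i))) \<in> hat_ladder"
      then obtain z where z: "z \<noteq> Elt (lower (Suc i))" "z \<noteq> Elt (upper (Suc i))" "(z, Elt (upper (Suc i))) \<in> hat_ladder"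
        "(Elt (lower (Suc i)), z) \<in> hat_ladder"
        by blast
      from z(4) show False
        by (cases rule: hat_ladder_cases) (use z in \<open>auto simp: le_Suc_eq\<close>)
    qed (use i in simp_all)
    moreover have "Elt (lower i) \<noteq> Elt (upper (Suc i))"
      by simp
    ultimately show ?thesis
      by blast
  qed
  have upj: "\<exists>!y. covered_by hat_ladder (Elt (upper j)) y" if "j \<le> n" for j
    using that up up0 by (cases j) auto
  have lowj: "(\<exists>!y. covered_by hat_ladder (Elt (lower j)) y) \<longleftrightarrow> j = 0" if "j \<le> n" for j
    using that low low0 by (cases j) auto
  have iff: "x \<in> meet_irreducibles hat_ladder \<longleftrightarrow> x \<in> {Bot, Elt 2} \<union> Elt ` upper ` {..n}"
    if "x \<in> Field hat_ladder" for x
  proof -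
    consider "x = Bot" | "x = Top" | j where "j \<le> n" "x = Elt (upper j)" | j where "j \<le> n" "x = Elt (lower j)"
      using \<open>x \<in> Field hat_ladder\<close> unfolding Field_hat_ladder by auto
    then show ?thesis
      using that unfolding meet_irreducibles_def
      by cases (auto simp: bot upj lowj Elt_2_eq)
  qed
  have sub: "meet_irreducibles hat_ladder \<subseteq> Field hat_ladder"
    by (auto simp: meet_irreducibles_def)
  have sup: "{Bot, Elt 2} \<union> Elt ` upper ` {..n} \<subseteq> Field hat_ladder"
    unfolding Field_hat_ladder Elt_2_eq by auto
  show ?thesis
    by (rule Set.set_eqI) (meson iff subsetD[OF sub] subsetD[OF sup])
qed

end

section \<open>The order polytope in coordinates\<close>

definition indicator_vector :: "'a set \<Rightarrow> 'a \<Rightarrow>\<^sub>0 real" where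
  "indicator_vector F = Abs_poly_mapping (\<lambda>e. of_bool (e \<in> F))"

lemma lookup_indicator_vector: "finite F \<Longrightarrow> Poly_Mapping.lookup (indicator_vector F) e = of_bool (e \<in> F)"
  by (simp add: indicator_vector_def)

lemma lookup_scaleR:
  "Poly_Mapping.lookup (c *\<^sub>R x) e = c *\<^sub>R Poly_Mapping.lookup x e" for x :: "'a \<Rightarrow>\<^sub>0 'b::real_vector"
proof -
  have "{e. c *\<^sub>R Poly_Mapping.lookup x e \<noteq> 0} \<subseteq> {e. Poly_Mapping.lookup x e \<noteq> 0}"
    by auto
  then have "finite {e. c *\<^sub>R Poly_Mapping.lookup x e \<noteq> 0}"
    by (rule finite_subset) simp
  then show ?thesis
    by (simp add: scaleR_poly_mapping_def)
qed

lemma linear_lookup: "linear (\<lambda>x :: 'a \<Rightarrow>\<^sub>0 real. Poly_Mapping.lookup x e)"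
  by (rule linearI) (simp_all add: lookup_add lookup_scaleR)

context
  fixes n :: nat
  assumes n: "1 \<le> n"
begin

definition ground :: "nat hat set" where "ground = {Bot, Elt 2} \<union> Elt ` upper ` {..n}"

lemma snake_Q_eq: "snake_Q (replicate (n - 1) LetterL) = Restr (hat_ladder n) ground"
  unfolding snake_Q_def Let_def snake_poset_eq_ladder[OF n] hat_ladder_def[symmetric]
    meet_irreducibles_hat_ladder ground_def ..

lemma Elt_2_eq: "Elt 2 = Elt (lower 0)"
  by (simp add: lower_def)

lemma Field_snake_Q: "Field (snake_Q (replicate (n - 1) LetterL)) = ground"
proof
  have "(x, x) \<in> hat_ladder n" if "x \<in> ground" for x
    using that unfolding ground_def Elt_2_eq by auto
  then show "ground \<subseteq> Field (snake_Q (replicate (n - 1) LetterL))"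
    unfolding snake_Q_eq by (auto intro: FieldI1)
qed (unfold snake_Q_eq Field_def, blast)

lemma upper_neq_2 [simp]: "upper j \<noteq> 2" "2 \<noteq> upper j"
  by (auto simp: upper_def)

lemma lower_eq_2 [simp]: "lower j = 2 \<longleftrightarrow> j = 0" "2 = lower j \<longleftrightarrow> j = 0"
  by (auto simp: lower_def)

lemma hat_ladder_2 [simp]: "(Bot, Elt 2) \<in> hat_ladder n" "(Elt 2, Elt (upper 0)) \<in> hat_ladder n"
  unfolding Elt_2_eq by simp_all

lemma ground_simps [simp]: "Bot \<in> ground" "Elt 2 \<in> ground" "Elt (upper j) \<in> ground \<longleftrightarrow> j \<le> n"
  by (auto simp: ground_def)

text \<open>It suffices to keep the inequalities of cover relations, the lower bound at the minimum
  and the upper bound at the maximum; all others follow along the chain.\<close>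

lemma order_polytope_snake_Q_iff:
  "x \<in> order_polytope (snake_Q (replicate (n - 1) LetterL)) \<longleftrightarrow>
    (\<forall>e. e \<notin> ground \<longrightarrow> Poly_Mapping.lookup x e = 0) \<and>
    0 \<le> Poly_Mapping.lookup x Bot \<and> Poly_Mapping.lookup x Bot \<le> Poly_Mapping.lookup x (Elt (upper n)) \<and>
    (\<forall>j<n. Poly_Mapping.lookup x (Elt (upper (Suc j))) \<le> Poly_Mapping.lookup x (Elt (upper j))) \<and>
    Poly_Mapping.lookup x Bot \<le> Poly_Mapping.lookup x (Elt 2) \<and>
    Poly_Mapping.lookup x (Elt 2) \<le> Poly_Mapping.lookup x (Elt (upper 0)) \<and>
    Poly_Mapping.lookup x (Elt (upper 0)) \<le> 1" (is "_ \<longleftrightarrow> ?R")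
proof
  assume x: "x \<in> order_polytope (snake_Q (replicate (n - 1) LetterL))"
  have mono: "Poly_Mapping.lookup x e \<le> Poly_Mapping.lookup x f"
    if "(e, f) \<in> hat_ladder n" "e \<in> ground" "f \<in> ground" "e \<noteq> f" for e f
    using x that unfolding order_polytope_def snake_Q_eq by blast
  have "0 \<le> Poly_Mapping.lookup x e" "Poly_Mapping.lookup x e \<le> 1" if "e \<in> ground" for e
    using x that unfolding order_polytope_def Field_snake_Q by blast+
  moreover have "Poly_Mapping.lookup x e = 0" if "e \<notin> ground" for e
    using x that unfolding order_polytope_def Field_snake_Q by (auto simp: in_keys_iff)
  moreover have "Poly_Mapping.lookup x Bot \<le> Poly_Mapping.lookup x (Elt 2)"
    by (rule mono) simp_all
  moreover have "Poly_Mapping.lookup x (Elt 2) \<le> Poly_Mapping.lookup x (Elt (upper 0))"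
    by (rule mono) simp_all
  moreover have "Poly_Mapping.lookup x Bot \<le> Poly_Mapping.lookup x (Elt (upper n))"
    by (rule mono) simp_all
  moreover have "Poly_Mapping.lookup x (Elt (upper (Suc j))) \<le> Poly_Mapping.lookup x (Elt (upper j))" if "j < n" for j
    using that by (intro mono) simp_all
  ultimately show ?R
    by simp
next
  assume R: ?R
  define y where "y j = Poly_Mapping.lookup x (Elt (upper j))" for j
  have anti: "y j \<le> y i" if "i \<le> j" "j \<le> n" for i j
    using that
  proof (induction j rule: dec_induct)
    case (step j)
    then show ?case
      using R unfolding y_def by (meson Suc_le_lessD less_imp_le order_trans)
  qed simp
  have bounds: "0 \<le> Poly_Mapping.lookup x e \<and> Poly_Mapping.lookup x e \<le> 1" if "e \<in> ground" for e
    using that unfolding ground_def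
  proof (elim UnE imageE)
    fix m j
    assume "e = Elt m" "m = upper j" "j \<in> {..n}"
    then show ?thesis
      using R anti[of j n] anti[of 0 j] by (auto simp: y_def)
  next
    assume "e \<in> {Bot, Elt 2}"
    then show ?thesis
      using R anti[of 0 n] by (auto simp: y_def)
  qed
  have "Poly_Mapping.lookup x e \<le> Poly_Mapping.lookup x f"
    if "(e, f) \<in> snake_Q (replicate (n - 1) LetterL)" for e f
  proof -
    have ef: "(e, f) \<in> hat_ladder n" "e \<in> ground" "f \<in> ground"
      using that unfolding snake_Q_eq by blast+
    from ef(1) show ?thesis
  proof (cases rule: hat_ladder_cases)
    case (4 j)
    then show ?thesis
      using R anti[of j n] by (simp add: y_def)
  next
    case (5 j)
    then have "j = 0"
      using ef(3) by (auto simp: ground_def Elt_2_eq)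
    then show ?thesis
      using R 5 by (simp add: Elt_2_eq)
  next
    case (8 i j)
    then show ?thesis
      using anti[of i j] by (simp add: y_def)
  next
    case (9 i j)
    then have "i = 0" "j = 0"
      using ef by (auto simp: ground_def Elt_2_eq)
    then show ?thesis
      using 9 by simp
  next
    case (10 i j)
    then have "i = 0" "j = 0"
      using ef(2) by (auto simp: ground_def Elt_2_eq)
    then show ?thesis
      using R 10 by (simp add: Elt_2_eq)
  qed (use ef in \<open>auto simp: ground_def\<close>)
  qed
  then show "x \<in> order_polytope (snake_Q (replicate (n - 1) LetterL))"
    using R bounds unfolding order_polytope_def Field_snake_Q by (auto simp: in_keys_iff)
qed

lemma convex_order_polytope_snake_Q: "convex (order_polytope (snake_Q (replicate (n - 1) LetterL)))"
proof (rule convexI)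
  fix x y :: "nat hat \<Rightarrow>\<^sub>0 real" and u v :: real
  assume "x \<in> order_polytope (snake_Q (replicate (n - 1) LetterL))"
    "y \<in> order_polytope (snake_Q (replicate (n - 1) LetterL))" and uv: "0 \<le> u" "0 \<le> v" "u + v = 1"
  then show "u *\<^sub>R x + v *\<^sub>R y \<in> order_polytope (snake_Q (replicate (n - 1) LetterL))"
    unfolding order_polytope_snake_Q_iff
    by (simp add: lookup_add lookup_scaleR add_mono mult_left_mono convex_bound_le)
qed

text \<open>Since indices grow downwards, an initial segment of them is a filter.\<close>

definition chain :: "nat \<Rightarrow> nat hat set" where "chain i = Elt ` upper ` {..<i}"

lemma finite_chain [simp]: "finite (chain i)"
  by (simp add: chain_def)

lemma chain_simps [simp]: "Bot \<notin> chain i" "Elt 2 \<notin> chain i" "Elt (upper j) \<in> chain i \<longleftrightarrow> j < i"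
  by (auto simp: chain_def)

lemma chain_subset_ground: "e \<in> chain i \<Longrightarrow> i \<le> n + 1 \<Longrightarrow> e \<in> ground"
  by (auto simp: chain_def ground_def)

text \<open>With \<open>i\<close> from 1 to \<open>n + 1\<close>, the vectors \<open>va i\<close>,
  \<open>vb i\<close>, \<open>vq\<close> and \<open>0\<close> belong to the filters of the poset:
  nonempty ones avoiding the minimum, with and without the side element \<open>Elt 2\<close>, the
  whole poset, and the empty filter.\<close>

definition va :: "nat \<Rightarrow> nat hat \<Rightarrow>\<^sub>0 real" where "va i = indicator_vector (insert (Elt 2) (chain i))"

definition vb :: "nat \<Rightarrow> nat hat \<Rightarrow>\<^sub>0 real" where "vb i = indicator_vector (chain i)"

definition vq :: "nat hat \<Rightarrow>\<^sub>0 real" where "vq = indicator_vector (insert Bot (insert (Elt 2) (chain (n + 1))))"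

lemma lookup_vertices:
  "Poly_Mapping.lookup (va i) e = of_bool (e = Elt 2 \<or> e \<in> chain i)"
  "Poly_Mapping.lookup (vb i) e = of_bool (e \<in> chain i)"
  "Poly_Mapping.lookup vq e = of_bool (e = Bot \<or> e = Elt 2 \<or> e \<in> chain (n + 1))"
  by (simp_all add: va_def vb_def vq_def lookup_indicator_vector)

text \<open>
  Index \<open>n + 1\<close> stands for the minimum, so that consecutive differences of levels give all
  \<open>n + 1\<close> coordinates \<open>s i\<close> of the prism.
\<close>

definition level :: "(nat hat \<Rightarrow>\<^sub>0 real) \<Rightarrow> nat \<Rightarrow> real" where
  "level x j = Poly_Mapping.lookup x (if j \<le> n then Elt (upper j) else Bot)"

definition cs :: "nat \<Rightarrow> (nat hat \<Rightarrow>\<^sub>0 real) \<Rightarrow> real" where "cs i x = level x (i - 1) - level x i"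

text \<open>Subtracting the coordinate at \<open>Bot\<close> makes the functional vanish at
  \<open>vq\<close>.\<close>

definition ct :: "(nat hat \<Rightarrow>\<^sub>0 real) \<Rightarrow> real" where
  "ct x = Poly_Mapping.lookup x (Elt 2) - Poly_Mapping.lookup x Bot"

lemma snake_prism: "prism (n + 1) va vb vq cs ct (\<lambda>x. Poly_Mapping.lookup x Bot)"
proof (rule prism.intro)
  show "linear (cs i)" for i
    unfolding cs_def[abs_def] level_def by (intro linear_compose_sub linear_lookup)
  show "linear ct"
    unfolding ct_def[abs_def] by (intro linear_compose_sub linear_lookup)
  show "linear (\<lambda>x :: nat hat \<Rightarrow>\<^sub>0 real. Poly_Mapping.lookup x Bot)"
    by (rule linear_lookup)
  show "va i + vb j = va j + vb i" for i j
    by (rule poly_mapping_eqI) (auto simp: lookup_add lookup_vertices)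
qed (auto simp: cs_def ct_def level_def lookup_vertices of_bool_def)

interpretation prism "n + 1" va vb vq cs ct "\<lambda>x. Poly_Mapping.lookup x Bot"
  by (rule snake_prism)

text \<open>For the nontrivial inclusion, the level differences serve as column weights, and every
  column is split between top and bottom in the same ratio \<theta>, chosen so that the total on top
  is \<open>ct x\<close>.\<close>

lemma order_polytope_eq_hull: "order_polytope (snake_Q (replicate (n - 1) LetterL)) = convex hull V"
proof
  have "v \<in> order_polytope (snake_Q (replicate (n - 1) LetterL))" if "v \<in> V" for v
    using that unfolding order_polytope_snake_Q_iff
    by (cases v rule: V_cases) (auto simp: lookup_vertices dest: chain_subset_ground)
  then show "convex hull V \<subseteq> order_polytope (snake_Q (replicate (n - 1) LetterL))"
    by (intro hull_minimal convex_order_polytope_snake_Q subsetI)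
  show "order_polytope (snake_Q (replicate (n - 1) LetterL)) \<subseteq> convex hull V"
  proof
    fix x
    assume "x \<in> order_polytope (snake_Q (replicate (n - 1) LetterL))"
    note x = this[unfolded order_polytope_snake_Q_iff]
    define S where "S = level x 0 - Poly_Mapping.lookup x Bot"
    \<comment> \<open>If \<open>S = 0\<close>, then \<open>ct x = 0\<close> too, and division by
      zero gives \<theta> the value 0, so \<open>S * \<theta> = ct x\<close> persists.\<close>
    define \<theta> where "\<theta> = ct x / S"
    have "(\<Sum>i=Suc 0..Suc n. cs i x) = (\<Sum>k=0..n. level x k - level x (k + 1))"
      unfolding sum.shift_bounds_cl_Suc_ivl by (simp add: cs_def)
    then have S: "(\<Sum>i=1..n+1. cs i x) = S"
      unfolding sum_natinterval_diff by (simp add: S_def level_def)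
    have "0 \<le> ct x" "ct x \<le> S"
      using x by (auto simp: ct_def S_def level_def)
    then have \<theta>: "0 \<le> \<theta>" "\<theta> \<le> 1" "S * \<theta> = ct x"
      by (auto simp: \<theta>_def divide_simps)
    have cs: "0 \<le> cs i x" if i: "i \<in> {1..n+1}" for i
    proof (cases "i = n + 1")
      case True
      then show ?thesis
        using x by (simp add: cs_def level_def)
    next
      case False
      then show ?thesis
        using x i by (cases i) (auto simp: cs_def level_def)
    qed
    obtain w :: "(nat hat \<Rightarrow>\<^sub>0 real) \<Rightarrow> real" where
      w: "w 0 = 1 - level x 0" "w vq = Poly_Mapping.lookup x Bot"
      "\<And>i. i \<in> {1..n+1} \<Longrightarrow> w (va i) = cs i x * \<theta>"
      "\<And>i. i \<in> {1..n+1} \<Longrightarrow> w (vb i) = cs i x * (1 - \<theta>)" "\<And>v. v \<notin> V \<Longrightarrow> w v = 0"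
      using coefficients_exist[of "1 - level x 0" "Poly_Mapping.lookup x Bot" "\<lambda>i. cs i x * \<theta>" "\<lambda>i. cs i x * (1 - \<theta>)"]
      by metis
    have nonneg: "0 \<le> w v" for v
    proof (cases "v \<in> V")
      case True
      then show ?thesis
        using cs \<theta> x by (cases v rule: V_cases) (auto simp: w level_def)
    qed (simp add: w)
    have sum_a: "(\<Sum>i=1..n+1. w (va i)) = ct x"
    proof -
      have "(\<Sum>i=1..n+1. w (va i)) = (\<Sum>i=1..n+1. cs i x * \<theta>)"
        by (intro sum.cong refl) (simp only: w)
      then show ?thesis
        using S \<theta>(3) by (simp only: sum_distrib_right[symmetric])
    qed
    have sum_b: "(\<Sum>i=1..n+1. w (vb i)) = S - ct x"
    proof -
      have "(\<Sum>i=1..n+1. w (vb i)) = (\<Sum>i=1..n+1. cs i x * (1 - \<theta>))"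
        by (intro sum.cong refl) (simp only: w)
      also have "\<dots> = S * (1 - \<theta>)"
        using S by (simp only: sum_distrib_right[symmetric])
      finally show ?thesis
        using \<theta>(3) by (simp add: algebra_simps)
    qed
    have sum_w: "sum w V = 1"
      unfolding sum_V sum_a sum_b w(1,2) S_def by simp
    define d where "d = x - (\<Sum>v\<in>V. w v *\<^sub>R v)"
    have d_outside: "Poly_Mapping.lookup d e = 0" if e: "e \<notin> ground" for e
    proof -
      have "Poly_Mapping.lookup v e = 0" if "v \<in> V" for v
        using that
        by (cases v rule: V_cases) (use e in \<open>auto simp: lookup_vertices dest: chain_subset_ground\<close>)
      then show ?thesis
        using x e by (simp add: d_def lookup_minus lookup_sum lookup_scaleR)
    qed
    have d_Bot: "Poly_Mapping.lookup d Bot = 0"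
      using g_combination[of w] by (simp add: d_def lookup_minus w(2))
    have "ct d = ct x - ct (\<Sum>v\<in>V. w v *\<^sub>R v)"
      unfolding d_def by (rule linear_diff[OF linear_t])
    then have "ct d = 0"
      using t_combination[of w] sum_a by simp
    then have d_2: "Poly_Mapping.lookup d (Elt 2) = 0"
      using d_Bot by (simp add: ct_def)
    have cs_d: "cs i d = 0" if i: "i \<in> {1..n+1}" for i
    proof -
      have "cs i d = cs i x - cs i (\<Sum>v\<in>V. w v *\<^sub>R v)"
        unfolding d_def by (rule linear_diff[OF linear_s])
      then show ?thesis
        using s_combination[OF i, of w] by (simp add: w(3,4)[OF i] algebra_simps)
    qed
    \<comment> \<open>From the minimum at index \<open>n + 1\<close>, where \<open>d\<close>
      vanishes, the vanishing differences propagate up the chain.\<close>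
    have level_d: "level d j = 0" if "j \<le> n + 1" for j
      using that
    proof (induction j rule: inc_induct)
      case base
      then show ?case
        using d_Bot by (simp add: level_def)
    next
      case (step j)
      then show ?case
        using cs_d[of "Suc j"] by (simp add: cs_def)
    qed
    have "Poly_Mapping.lookup d e = 0" for e
    proof (cases "e \<in> ground")
      case True
      then consider "e = Bot" | "e = Elt 2" | j where "j \<le> n" "e = Elt (upper j)"
        by (auto simp: ground_def)
      then show ?thesis
      proof cases
        case 3
        then show ?thesis
          using level_d[of j] by (simp add: level_def)
      qed (use d_Bot d_2 in simp_all)
    qed (rule d_outside)
    then have "d = 0"
      by (intro poly_mapping_eqI) simp
    then have "(\<Sum>v\<in>V. w v *\<^sub>R v) = x"
      by (simp add: d_def)
    then show "x \<in> convex hull V"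
      unfolding mem_convex_hull_iff[OF subset_refl] using nonneg sum_w w(5) by (intro exI[of _ w]) simp
  qed
qed

section \<open>Comparison with the Cayley graph\<close>

lemma cayley_graph_edge_iff:
  assumes \<pi>: "\<pi> permutes {1..n+1}" and \<rho>: "\<rho> permutes {1..n+1}"
  shows "{\<pi>, \<rho>} \<in> snd (cayley_graph (sym_group (n + 1)) (simple_transpositions n)) \<longleftrightarrow>
    (\<exists>i. i \<in> {1..n+1} \<and> Suc i \<in> {1..n+1} \<and> \<rho> = \<pi> \<circ> Transposition.transpose i (Suc i))" (is "_ \<longleftrightarrow> ?R \<pi> \<rho>")
proof
  have sym: "?R \<rho> \<pi> \<Longrightarrow> ?R \<pi> \<rho>" for \<pi> \<rho> :: "nat \<Rightarrow> nat"
    by (metis comp_assoc comp_id transpose_comp_involutory)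
  assume "{\<pi>, \<rho>} \<in> snd (cayley_graph (sym_group (n + 1)) (simple_transpositions n))"
  then obtain h i where h: "{\<pi>, \<rho>} = {h, h \<circ> Transposition.transpose i (i + 1)}" and i: "1 \<le> i" "i \<le> n"
    by (auto simp: cayley_graph_def simple_transpositions_def sym_group_mult)
  have "?R h (h \<circ> Transposition.transpose i (i + 1))"
    using i by (intro exI[of _ i]) simp
  then have "?R \<pi> \<rho> \<or> ?R \<rho> \<pi>"
    using h unfolding doubleton_eq_iff by metis
  then show "?R \<pi> \<rho>"
    using sym by blast
next
  assume "?R \<pi> \<rho>"
  then obtain i where "i \<in> {1..n+1}" "Suc i \<in> {1..n+1}" "\<rho> = \<pi> \<circ> Transposition.transpose i (Suc i)"
    by blast
  then have i: "1 \<le> i" "i \<le> n" "\<rho> = \<pi> \<circ> Transposition.transpose i (i + 1)"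
    by simp_all
  have "\<pi> \<noteq> \<rho>"
  proof
    assume "\<pi> = \<rho>"
    then have "\<pi> i = \<pi> (i + 1)"
      using i(3) by (metis comp_apply transpose_apply_first)
    then show False
      using injD[OF permutes_inj[OF \<pi>], of i "i + 1"] by simp
  qed
  moreover have "Transposition.transpose i (i + 1) \<in> simple_transpositions n"
    using i by (auto simp: simple_transpositions_def)
  ultimately show "{\<pi>, \<rho>} \<in> snd (cayley_graph (sym_group (n + 1)) (simple_transpositions n))"
    using \<pi> i(3) unfolding cayley_graph_def snd_conv sym_group_mult sym_group_carrier by blast
qed

lemma flip_graph_isomorphic_cayley_graph:
  "ugraph_isomorphic (flip_graph (order_polytope (snake_Q (replicate (n - 1) LetterL))))
    (cayley_graph (sym_group (n + 1)) (simple_transpositions n))"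
  unfolding ugraph_isomorphic_def order_polytope_eq_hull
proof (intro exI conjI ballI)
  let ?S = "{\<pi>. \<pi> permutes {1..n+1}}"
  let ?f = "inv_into ?S tri"
  have fst: "fst (flip_graph (convex hull V)) = polytope_triangulations (convex hull V)"
    "fst (cayley_graph (sym_group (n + 1)) (simple_transpositions n)) = ?S"
    by (simp_all add: flip_graph_def cayley_graph_def sym_group_def)
  show "bij_betw ?f (fst (flip_graph (convex hull V)))
      (fst (cayley_graph (sym_group (n + 1)) (simple_transpositions n)))"
    unfolding fst by (rule bij_betw_inv_into[OF bij_betw_tri])
  fix T T'
  assume "T \<in> fst (flip_graph (convex hull V))" "T' \<in> fst (flip_graph (convex hull V))"
  then obtain \<pi> \<rho> where \<pi>: "\<pi> permutes {1..n+1}" "T = tri \<pi>" and \<rho>: "\<rho> permutes {1..n+1}" "T' = tri \<rho>"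
    unfolding fst using triangulation_eq_tri by metis
  have "?f T = \<pi>" "?f T' = \<rho>"
    using inv_into_f_f[OF inj_on_tri] \<pi> \<rho> by auto
  then show "{T, T'} \<in> snd (flip_graph (convex hull V)) \<longleftrightarrow>
      {?f T, ?f T'} \<in> snd (cayley_graph (sym_group (n + 1)) (simple_transpositions n))"
    using flip_graph_edge_iff[OF \<pi>(1) \<rho>(1)] cayley_graph_edge_iff[OF \<pi>(1) \<rho>(1)] \<pi>(2) \<rho>(2) by simp
qed

end

theorem theorem5p2:
  fixes n :: nat
  assumes "n \<ge> 1"
  shows "ugraph_isomorphic
           (flip_graph (order_polytope (snake_Q (replicate (n - 1) LetterL))))
           (cayley_graph (sym_group (n + 1)) (simple_transpositions n))"
  using assms by (rule flip_graph_isomorphic_cayley_graph)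

end
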